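(* Let $\{a_n\}_{n\ge 0}$ be a sequence of non-negative real numbers with $a_0>0$ and $\lim_{n\to\infty}\frac{\log a_n}{n}=-\infty$, let $\{\xi_n\}_{n\ge0}$ be independent standard complex Gaussian random variables, and let $f(z)=\sum_{n=0}^\infty \xi_n a_n z^n$. Then there exists a set $E\subset[1,\infty)$, depending only on the sequence $\{a_n\}$, with $\int_E \frac{dt}{t}<\infty$, such that $$p_H(r)=S(r)+o(S(r))\qquad\text{as } r\to\infty,\ r\notin E;$$ that is, for every $\varepsilon>0$ there is $r_0$ such that $|p_H(r)-S(r)|\le\varepsilon S(r)$ for all $r\ge r_0$ with $r\notin E$.
   Context: A standard complex Gaussian is a $\mathbb{C}$-valued random variable with density $\frac1\pi e^{-|z|^2}$. Convention: $\log 0=-\infty$. Under the stated condition on $a_n$, $f$ is almost surely an entire function. Notation: $\log^+x=\max(\log x,0)$ (with $\log^+0=0$), $$S(r)=2\sum_{n\ge0}\log^+(a_nr^n),\qquad p_H(r)=-\log\mathbb{P}\big(f(z)\neq0\text{ for all }|z|<r\big).$$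
   Formalization: If a_0>1, some a_n with n≥1 is assumed positive: otherwise f is a nonzero constant a.s., p_H=0 but S=2 log a_0>0, so the claim fails. E is chosen per sample-space type, which loses nothing as p_H depends only on the law of the ξ_n. *)

theory Defs
  imports "HOL-Probability.Probability"
begin

text \<open>Logarithm with the convention $\log 0 = -\infty$.\<close>

definition elog :: "real \<Rightarrow> ereal" where
  "elog x = (if x = 0 then -\<infinity> else ereal (ln x))"

text \<open>Here \<open>logp 0 = 0\<close>, because \<open>ln 0 = 0\<close> in the library.\<close>

definition logp :: "real \<Rightarrow> real" where
  "logp x = max (ln x) 0"

definition S :: "(nat \<Rightarrow> real) \<Rightarrow> real \<Rightarrow> real" where
  "S a r = 2 * (\<Sum>n. logp (a n * r ^ n))"

definition std_complex_gaussian_density :: "complex \<Rightarrow> real" where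
  "std_complex_gaussian_density z = exp (- (cmod z)\<^sup>2) / pi"

definition iid_std_complex_gaussian :: "'w measure \<Rightarrow> (nat \<Rightarrow> 'w \<Rightarrow> complex) \<Rightarrow> bool" where
  "iid_std_complex_gaussian M \<xi> \<longleftrightarrow>
     prob_space M \<and>
     prob_space.indep_vars M (\<lambda>_. borel) \<xi> UNIV \<and>
     (\<forall>n. distributed M lborel (\<xi> n) (\<lambda>z. ennreal (std_complex_gaussian_density z)))"

definition gef :: "(nat \<Rightarrow> real) \<Rightarrow> (nat \<Rightarrow> 'w \<Rightarrow> complex) \<Rightarrow> 'w \<Rightarrow> complex \<Rightarrow> complex" where
  "gef a \<xi> \<omega> z = (\<Sum>n. \<xi> n \<omega> * of_real (a n) * z ^ n)"

text \<open>
  The power series converges everywhere only almost surely. The outcomes for which it does not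
  are excluded, since on them the value of the infinite sum is arbitrary and the remaining
  condition need not define a measurable set.
\<close>

definition hole_event ::
    "'w measure \<Rightarrow> (nat \<Rightarrow> real) \<Rightarrow> (nat \<Rightarrow> 'w \<Rightarrow> complex) \<Rightarrow> real \<Rightarrow> 'w set" where
  "hole_event M a \<xi> r =
     {\<omega> \<in> space M. (\<forall>z. summable (\<lambda>n. \<xi> n \<omega> * of_real (a n) * z ^ n)) \<and>
                   (\<forall>z. cmod z < r \<longrightarrow> gef a \<xi> \<omega> z \<noteq> 0)}"

text \<open>The probability is positive whenever \<open>a 0 > 0\<close>, so the library value \<open>ln 0 = 0\<close> plays no role.\<close>

definition p_H :: "'w measure \<Rightarrow> (nat \<Rightarrow> real) \<Rightarrow> (nat \<Rightarrow> 'w \<Rightarrow> complex) \<Rightarrow> real \<Rightarrow> real" where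
  "p_H M a \<xi> r = - ln (measure M (hole_event M a \<xi> r))"

end

theory Submission
  imports Defs "HOL-Complex_Analysis.Complex_Analysis" "HOL-Real_Asymp.Real_Asymp"
begin

text \<open>
  Write \<open>I(r) = {k. a k * r ^ k > 1}\<close> and \<open>n = card (I r)\<close>, so that
  \<open>exp (- S a r)\<close> is the product of \<open>(a k * r ^ k) ^ (-2)\<close> over \<open>k \<in> I r\<close>. The linear map
  from \<open>(\<xi> k)\<close> to \<open>(\<xi> k * a k * r ^ k)\<close>, \<open>k \<in> I r\<close>, expands volume by the factor \<open>exp (S a r)\<close>. The
  theorem says that in the second set of coordinates the hole event has, up to factors
  \<open>exp (o (S a r))\<close>, volume of order \<open>1\<close>.

  The hole probability is not much smaller than \<open>exp (- S a r)\<close> (\<open>hole_probability_ge\<close>): the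
  constant term dominates all others on \<open>\<bar>z\<bar> < r\<close> when \<open>\<xi> 0\<close> is moderately large, \<open>\<xi> k * a k * r ^ k\<close>
  is of order \<open>1 / n\<close> for the finitely many relevant \<open>k\<close>, and the remaining \<open>\<xi> k\<close> obey a slowly
  growing bound. These conditions are independent, and a disc of radius \<open>x\<close> around the origin has
  Gaussian probability about \<open>x ^ 2\<close>.

  The hole probability is not much larger (\<open>hole_probability_le\<close>): if \<open>f\<close> has no zero in
  \<open>\<bar>z\<bar> < r\<close>, every branch of \<open>f ^ (-s)\<close> is holomorphic there. The mean value property of
  \<open>\<Prod>j. f (z * u j) ^ (-s)\<close>, for \<open>n\<close> points \<open>u j\<close> of the unit circle, gives
  \<open>\<bar>f 0\<bar> ^ (- s * n) \<le> average of \<Prod>j. \<bar>f (\<rho> * e ^ (i * t) * u j)\<bar> ^ (-s)\<close> over \<open>t\<close> for \<open>\<rho> < r\<close>.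
  Conditionally on the coefficients outside \<open>I r\<close>, the vector of the values \<open>f (\<rho> * e ^ (i * t) * u j)\<close> is
  an affine image of \<open>(\<xi> k)\<close>, \<open>k \<in> I r\<close>. If the points are such that the generalised Vandermonde
  determinant of the exponents \<open>I r\<close> is at least \<open>1\<close> in modulus, then the density of this vector is
  at most \<open>pi ^ (-n)\<close> times the product of the \<open>(a k * \<rho> ^ k) ^ (-2)\<close>. Such points exist for any set
  of exponents, with gaps or without (\<open>interpolation_points\<close>). With \<open>s = 2 - d\<close> for a small
  \<open>d > 0\<close> the power \<open>\<bar>w\<bar> ^ (-s)\<close> is integrable at the origin, its integral over \<open>\<bar>w\<bar> \<le> R\<close> is of order
  \<open>R ^ d / d\<close>, and \<open>d = 1 / ln R\<close> makes this \<open>ln R\<close>. Taking \<open>R = exp (3 * S a r)\<close>, the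
  whole loss is a factor \<open>(S a r) ^ O(n)\<close>.

  The errors of both bounds are of the form \<open>n\<close> times powers of \<open>ln (S a r)\<close>, or powers of \<open>1 / g\<close>
  where \<open>exp g\<close> is the ratio of radii that makes the terms outside \<open>I (r * exp g)\<close> decay
  geometrically. The exceptional set covers the radii at which \<open>S\<close> more than doubles within
  a logarithmic distance \<open>h\<close> of order \<open>1 / (ln (S a r)) ^ 2\<close>; it has finite logarithmic measure because these
  distances are summable over the dyadic levels of \<open>S\<close> (\<open>exceptional_measure\<close>). As the derivative of
  \<open>S\<close> in \<open>ln r\<close> is at least \<open>n * (n - 1)\<close>, the absence of doubling forces \<open>n\<close> to be at most
  \<open>sqrt (S a r)\<close> up to a logarithm (\<open>regular_radius\<close>), so that all errors are \<open>o (S a r)\<close>.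
\<close>

section \<open>Points on the circle with large generalised Vandermonde determinant\<close>

lemma lborel_product_sigma_finite: "product_sigma_finite (\<lambda>_. lborel :: 'a::euclidean_space measure)"
  by (simp add: product_sigma_finite_def lborel.sigma_finite_measure_axioms)

lemma nn_integral_lborel_translate:
  fixes h :: "'a::euclidean_space \<Rightarrow> ennreal"
  assumes [measurable]: "h \<in> borel_measurable borel"
  shows "(\<integral>\<^sup>+x. h (x + v) \<partial>lborel) = (\<integral>\<^sup>+x. h x \<partial>lborel)"
proof -
  have "(\<integral>\<^sup>+x. h x \<partial>lborel) = (\<integral>\<^sup>+x. h x \<partial>distr lborel borel ((+) v))"
    by (simp add: lborel_distr_plus)
  also have "\<dots> = (\<integral>\<^sup>+x. h (v + x) \<partial>lborel)" by (subst nn_integral_distr) auto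
  finally show ?thesis by (simp add: add.commute)
qed

lemma nn_integral_lborel_scale:
  fixes h :: "'a::euclidean_space \<Rightarrow> ennreal"
  assumes [measurable]: "h \<in> borel_measurable borel" and c: "c \<noteq> 0"
  shows "(\<integral>\<^sup>+x. h x \<partial>lborel) = ennreal (\<bar>c\<bar> ^ DIM('a)) * (\<integral>\<^sup>+x. h (c *\<^sub>R x) \<partial>lborel)"
proof -
  have "(\<integral>\<^sup>+x. h x \<partial>lborel) = (\<integral>\<^sup>+x. h x \<partial>density (distr lborel borel (\<lambda>x. 0 + c *\<^sub>R x)) (\<lambda>_. \<bar>c\<bar> ^ DIM('a)))"
    by (subst lborel_affine[OF c, of 0]) simp
  also have "\<dots> = (\<integral>\<^sup>+x. ennreal (\<bar>c\<bar> ^ DIM('a)) * h (c *\<^sub>R x) \<partial>lborel)"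
    by (subst nn_integral_density) (auto simp: nn_integral_distr)
  also have "\<dots> = ennreal (\<bar>c\<bar> ^ DIM('a)) * (\<integral>\<^sup>+x. h (c *\<^sub>R x) \<partial>lborel)"
    by (subst nn_integral_cmult) auto
  finally show ?thesis .
qed

definition radial :: "(complex \<Rightarrow> ennreal) \<Rightarrow> bool" where
  "radial G \<longleftrightarrow> (\<forall>z z'. cmod z = cmod z' \<longrightarrow> G z = G z')"

text \<open>
  For a radial function the phase of the factor \<open>c\<close> can be dropped, so only translations and
  real dilations of the plane are involved.
\<close>

lemma nn_integral_radial_affine:
  assumes [measurable]: "G \<in> borel_measurable borel" and G: "radial G" and c: "c \<noteq> 0"
  shows "(\<integral>\<^sup>+x. G (w + c * x) \<partial>lborel) = ennreal (inverse (cmod c ^ 2)) * (\<integral>\<^sup>+x. G x \<partial>lborel)"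
proof -
  have eq: "G (w + c * x) = G (cmod c *\<^sub>R (x + w / c))" for x
  proof -
    have "w + c * x = c * (x + w / c)" using c by (simp add: field_simps)
    then have "cmod (w + c * x) = cmod (cmod c *\<^sub>R (x + w / c))"
      by (metis abs_norm_cancel norm_mult norm_scaleR)
    then show ?thesis using G by (auto simp: radial_def)
  qed
  have "(\<integral>\<^sup>+x. G (w + c * x) \<partial>lborel) = (\<integral>\<^sup>+x. G (cmod c *\<^sub>R (x + w / c)) \<partial>lborel)"
    by (simp add: eq)
  also have "\<dots> = (\<integral>\<^sup>+x. G (cmod c *\<^sub>R x) \<partial>lborel)"
    by (rule nn_integral_lborel_translate[where h="\<lambda>x. G (cmod c *\<^sub>R x)"]) measurable
  finally have 1: "(\<integral>\<^sup>+x. G (w + c * x) \<partial>lborel) = (\<integral>\<^sup>+x. G (cmod c *\<^sub>R x) \<partial>lborel)" .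
  have 2: "(\<integral>\<^sup>+x. G x \<partial>lborel) = ennreal (cmod c ^ 2) * (\<integral>\<^sup>+x. G (cmod c *\<^sub>R x) \<partial>lborel)"
    using nn_integral_lborel_scale[of G "cmod c"] c by simp
  have "ennreal (inverse (cmod c ^ 2)) * ennreal (cmod c ^ 2) = 1"
    using c by (subst ennreal_mult[symmetric]) auto
  then show ?thesis unfolding 1 2 by (simp add: mult.assoc[symmetric])
qed

lemma nn_integral_PiM_translate:
  fixes h :: "(nat \<Rightarrow> complex) \<Rightarrow> ennreal"
  assumes "finite I" "h \<in> borel_measurable (PiM I (\<lambda>_. lborel))"
  shows "(\<integral>\<^sup>+x. h (\<lambda>i\<in>I. x i + v i) \<partial>PiM I (\<lambda>_. lborel)) = (\<integral>\<^sup>+x. h x \<partial>PiM I (\<lambda>_. lborel))"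
  using assms
proof (induction I arbitrary: h rule: finite_induct)
  case empty
  then show ?case by (simp add: PiM_empty nn_integral_count_space_finite restrict_def)
next
  case (insert k I)
  interpret product_sigma_finite "\<lambda>_::nat. lborel :: complex measure" by (rule lborel_product_sigma_finite)
  note [measurable] = insert.prems
  have meas[measurable]: "(\<lambda>x. h (\<lambda>i\<in>insert k I. x i + v i)) \<in> borel_measurable (PiM (insert k I) (\<lambda>_. lborel))"
    by measurable
  have c: "(\<lambda>p. (fst p)(k := snd p)) \<in> measurable (PiM I (\<lambda>_. lborel) \<Otimes>\<^sub>M lborel) (PiM (insert k I) (\<lambda>_. lborel :: complex measure))"
    by measurable
  have [measurable]: "(\<lambda>x. h (x(k := y))) \<in> borel_measurable (PiM I (\<lambda>_. lborel))" for y
    by measurable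
  have hm: "(\<lambda>y. h (x(k := y))) \<in> borel_measurable borel" if "x \<in> space (PiM I (\<lambda>_. lborel::complex measure))" for x
  proof -
    have "(\<lambda>y. (x(k := y))) \<in> measurable lborel (PiM (insert k I) (\<lambda>_. lborel :: complex measure))"
      using that by measurable
    then show ?thesis using insert.prems measurable_compose[of _ lborel _ h] by simp
  qed
  have eq: "(\<lambda>i\<in>insert k I. (x(k := y)) i + v i) = (\<lambda>i\<in>I. x i + v i)(k := y + v k)" for x :: "nat \<Rightarrow> complex" and y
    using insert.hyps by (auto simp: fun_eq_iff)
  have sp: "(\<lambda>i\<in>I. x i + v i) \<in> space (PiM I (\<lambda>_. lborel::complex measure))" for x
    by (auto simp: space_PiM)
  have "(\<integral>\<^sup>+x. h (\<lambda>i\<in>insert k I. x i + v i) \<partial>PiM (insert k I) (\<lambda>_. lborel)) =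
     (\<integral>\<^sup>+x. (\<integral>\<^sup>+y. h ((\<lambda>i\<in>I. x i + v i)(k := y + v k)) \<partial>lborel) \<partial>PiM I (\<lambda>_. lborel))"
    by (subst product_nn_integral_insert[OF insert.hyps meas]) (simp only: eq)
  also have "\<dots> = (\<integral>\<^sup>+x. (\<integral>\<^sup>+y. h ((\<lambda>i\<in>I. x i + v i)(k := y)) \<partial>lborel) \<partial>PiM I (\<lambda>_. lborel))"
    using nn_integral_lborel_translate[OF hm[OF sp], where v="v k"] by simp
  also have "\<dots> = (\<integral>\<^sup>+x. (\<integral>\<^sup>+y. h (x(k := y)) \<partial>lborel) \<partial>PiM I (\<lambda>_. lborel))"
    by (rule insert.IH[where h="\<lambda>x. \<integral>\<^sup>+y. h (x(k := y)) \<partial>lborel"]) measurable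
  also have "\<dots> = (\<integral>\<^sup>+x. h x \<partial>PiM (insert k I) (\<lambda>_. lborel))"
    by (rule product_nn_integral_insert[OF insert.hyps, symmetric]) measurable
  finally show ?case .
qed

text \<open>
  The function \<open>u ^ k - \<dots>\<close> has coefficient \<open>1\<close> at \<open>u ^ k\<close>, so its mean square on the circle is at least \<open>1\<close>.
  The mean is taken over the \<open>N\<close>-th roots of unity, which are orthogonal for exponents
  below \<open>N\<close>.
\<close>

lemma unit_circle_point_large:
  fixes c :: "nat \<Rightarrow> complex"
  assumes "finite I" "k \<notin> I"
  shows "\<exists>u. cmod u = 1 \<and> cmod (u ^ k - (\<Sum>l\<in>I. c l * u ^ l)) \<ge> 1"
proof (rule ccontr)
  assume neg: "\<not> ?thesis"
  \<comment> \<open>larger than all exponents, so that distinct exponents stay distinct modulo \<open>N\<close>\<close>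
  define N where "N = Suc (Max (insert k I))"
  have N: "l < N" if "l \<in> insert k I" for l
    using that assms unfolding N_def by (meson Max_ge finite.insertI le_imp_less_Suc)
  define w where "w = cis (2 * pi / real N)"
  have Npos: "N > 0" by (simp add: N_def)
  have roots: "(\<Sum>i<N. (w ^ i) ^ l * cnj ((w ^ i) ^ k)) = (if l = k then of_nat N else 0)" if "l \<in> insert k I" for l
  proof -
    define q where "q = w ^ l * cnj (w ^ k)"
    have "(\<Sum>i<N. (w ^ i) ^ l * cnj ((w ^ i) ^ k)) = (\<Sum>i<N. q ^ i)"
      by (simp add: q_def power_mult_distrib power_mult[symmetric] mult.commute)
    moreover have q: "q = cis (2 * pi * (real l - real k) / real N)"
      by (simp add: q_def w_def cis_cnj Complex.DeMoivre cis_mult field_simps)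
        (simp add: cis_mult[symmetric] cis_divide[symmetric] diff_divide_distrib)
    moreover have "q ^ N = 1"
    proof -
      have "q ^ N = cis (2 * pi * of_int (int l - int k))" using Npos by (simp add: q Complex.DeMoivre)
      also have "\<dots> = 1" by (rule cis_multiple_2pi) auto
      finally show ?thesis .
    qed
    moreover have "q \<noteq> 1" if "l \<noteq> k"
    proof
      assume "q = 1"
      then obtain m :: int where m: "2 * pi * (real l - real k) / real N = of_int m * (2 * pi)"
        unfolding q using cos_one_2pi_int by (metis cis.sel(1) one_complex.sel(1) mult.assoc)
      then have "pi * 2 * (real l - real k) = pi * 2 * (of_int m * real N)" using Npos by (simp add: field_simps)
      then have "real l - real k = of_int m * real N" by simp
      then have "int l - int k = m * int N"
        by (metis of_int_eq_iff of_int_diff of_int_mult of_int_of_nat_eq)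
      moreover have "\<bar>int l - int k\<bar> < int N" using N[OF \<open>l \<in> insert k I\<close>] N[of k] by auto
      ultimately have "\<bar>m\<bar> * int N < 1 * int N" by (simp add: abs_mult)
      then have "m = 0" using Npos by (simp only: mult_less_cancel_right) auto
      with \<open>int l - int k = m * int N\<close> that show False by auto
    qed
    ultimately show ?thesis by (auto simp: sum_gp_strict)
  qed
  let ?p = "\<lambda>u. u ^ k - (\<Sum>l\<in>I. c l * u ^ l)"
  have unit: "cmod (w ^ i) = 1" for i by (simp add: w_def norm_power)
  have "(\<Sum>i<N. ?p (w ^ i) * cnj ((w ^ i) ^ k)) =
        (\<Sum>i<N. (w ^ i) ^ k * cnj ((w ^ i) ^ k)) - (\<Sum>l\<in>I. c l * (\<Sum>i<N. (w ^ i) ^ l * cnj ((w ^ i) ^ k)))"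
    by (simp add: left_diff_distrib sum_subtractf sum_distrib_right sum_distrib_left mult.assoc) (rule sum.swap)
  also have "\<dots> = of_nat N"
    using roots assms(2) by (auto intro!: sum.neutral)
  finally have "real N = cmod (\<Sum>i<N. ?p (w ^ i) * cnj ((w ^ i) ^ k))" by simp
  also have "\<dots> \<le> (\<Sum>i<N. cmod (?p (w ^ i) * cnj ((w ^ i) ^ k)))" by (rule norm_sum)
  also have "\<dots> = (\<Sum>i<N. cmod (?p (w ^ i)))"
    using unit by (simp add: norm_mult norm_power)
  also have "\<dots> < (\<Sum>i<N. 1)"
    using neg unit Npos by (intro sum_strict_mono) (auto simp: not_le)
  finally show False by simp
qed

definition interpolating :: "nat set \<Rightarrow> (nat \<Rightarrow> complex) \<Rightarrow> bool" where
  "interpolating I u \<longleftrightarrow> (\<forall>y. \<exists>c. \<forall>j\<in>I. (\<Sum>k\<in>I. c k * u j ^ k) = y j)"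

text \<open>
  The bound that a change of variables yields when the matrix \<open>u j ^ k\<close>, with rows \<open>j\<close> and columns \<open>k\<close>
  in \<open>I\<close>, has determinant at least \<open>1\<close> in modulus. Stating the bound itself instead of the determinant
  lets it be proved by eliminating one coordinate at a time. The factors \<open>b k\<close> are complex and the
  shifts \<open>w j\<close> arbitrary so that the same points serve after a rotation of the circle and with all
  remaining coefficients frozen.
\<close>

definition contracting :: "nat set \<Rightarrow> (nat \<Rightarrow> complex) \<Rightarrow> bool" where
  "contracting I u \<longleftrightarrow>
     (\<forall>G b w. G \<in> borel_measurable borel \<longrightarrow> radial G \<longrightarrow> (\<forall>k\<in>I. b k \<noteq> 0) \<longrightarrow>
        (\<integral>\<^sup>+x. (\<Prod>j\<in>I. G (w j + (\<Sum>k\<in>I. b k * x k * u j ^ k))) \<partial>PiM I (\<lambda>_. lborel))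
        \<le> ennreal (\<Prod>k\<in>I. inverse (cmod (b k) ^ 2)) * (\<integral>\<^sup>+z. G z \<partial>lborel) ^ card I)"

lemma contractingD:
  assumes "contracting I u" "G \<in> borel_measurable borel" "radial G" "\<And>k. k \<in> I \<Longrightarrow> b k \<noteq> 0"
  shows "(\<integral>\<^sup>+x. (\<Prod>j\<in>I. G (w j + (\<Sum>k\<in>I. b k * x k * u j ^ k))) \<partial>PiM I (\<lambda>_. lborel))
        \<le> ennreal (\<Prod>k\<in>I. inverse (cmod (b k) ^ 2)) * (\<integral>\<^sup>+z. G z \<partial>lborel) ^ card I"
  using assms unfolding contracting_def by simp

text \<open>
  Gaussian elimination, one exponent at a time. Since the points chosen for \<open>I\<close> interpolate, some
  combination \<open>\<Sum>l\<in>I. c l * u ^ l\<close> agrees with \<open>u ^ k\<close> at all of them; the difference \<open>p\<close> vanishes there, and the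
  new point is one where \<open>\<bar>p\<bar> \<ge> 1\<close>. A shear of the old coordinates along the new one makes the
  system triangular: the old factors no longer involve the new coordinate, and in the new factor it
  has the coefficient \<open>b k * p\<close>.
\<close>

lemma interpolation_points:
  assumes "finite I"
  shows "\<exists>u. (\<forall>j\<in>I. cmod (u j) = 1) \<and> interpolating I u \<and> contracting I u"
  using assms
proof (induction I rule: finite_induct)
  case empty
  then show ?case by (simp add: interpolating_def contracting_def PiM_empty nn_integral_count_space_finite)
next
  case (insert k I)
  interpret product_sigma_finite "\<lambda>_::nat. lborel :: complex measure" by (rule lborel_product_sigma_finite)
  obtain u where u1: "\<And>j. j \<in> I \<Longrightarrow> cmod (u j) = 1" and "interpolating I u" and contr: "contracting I u"
    using insert.IH by blast
  then have solv: "\<exists>c. \<forall>j\<in>I. (\<Sum>k\<in>I. c k * u j ^ k) = y j" for y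
    by (simp add: interpolating_def)
  \<comment> \<open>interpolate \<open>u ^ k\<close> at the old points\<close>
  obtain c where c: "\<And>j. j \<in> I \<Longrightarrow> (\<Sum>l\<in>I. c l * u j ^ l) = u j ^ k"
    using solv[of "\<lambda>j. u j ^ k"] by blast
  obtain v where v: "cmod v = 1" "cmod (v ^ k - (\<Sum>l\<in>I. c l * v ^ l)) \<ge> 1"
    using unit_circle_point_large[OF insert.hyps] by blast
  define p where "p = v ^ k - (\<Sum>l\<in>I. c l * v ^ l)"
  have p1: "cmod p \<ge> 1" and p0: "p \<noteq> 0" using v by (auto simp: p_def)
  define u' where "u' = u(k := v)"
  have u'I: "u' j = u j" if "j \<in> I" for j using that insert.hyps by (auto simp: u'_def)
  have u'k: "u' k = v" by (simp add: u'_def)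
  have solv': "\<exists>d. \<forall>j\<in>insert k I. (\<Sum>l\<in>insert k I. d l * u' j ^ l) = y j" for y
  proof -
    obtain e where e: "\<And>j. j \<in> I \<Longrightarrow> (\<Sum>l\<in>I. e l * u j ^ l) = y j" using solv by blast
    define t where "t = (y k - (\<Sum>l\<in>I. e l * v ^ l)) / p"
    define d where "d = (\<lambda>l. if l = k then t else e l - t * c l)"
    have "(\<Sum>l\<in>insert k I. d l * x ^ l) = t * (x ^ k - (\<Sum>l\<in>I. c l * x ^ l)) + (\<Sum>l\<in>I. e l * x ^ l)" for x
    proof -
      have "(\<Sum>l\<in>I. d l * x ^ l) = (\<Sum>l\<in>I. e l * x ^ l - t * (c l * x ^ l))"
        using insert.hyps by (intro sum.cong) (auto simp: d_def algebra_simps)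
      then show ?thesis using insert.hyps
        by (simp add: sum_subtractf sum_distrib_left d_def algebra_simps)
    qed
    then have "\<forall>j\<in>insert k I. (\<Sum>l\<in>insert k I. d l * u' j ^ l) = y j"
      using c e p0 by (auto simp: u'I u'k p_def[symmetric] t_def)
    then show ?thesis by blast
  qed
  have bound': "(\<integral>\<^sup>+x. (\<Prod>j\<in>insert k I. G (w j + (\<Sum>l\<in>insert k I. b l * x l * u' j ^ l))) \<partial>PiM (insert k I) (\<lambda>_. lborel))
        \<le> ennreal (\<Prod>l\<in>insert k I. inverse (cmod (b l) ^ 2)) * (\<integral>\<^sup>+z. G z \<partial>lborel) ^ card (insert k I)"
    if G[measurable]: "G \<in> borel_measurable borel" and rad: "radial G" and b: "\<forall>k\<in>insert k I. b k \<noteq> 0" for G b w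
  proof -
    define A where "A = (\<lambda>x y. \<Prod>j\<in>insert k I. G (w j + (\<Sum>l\<in>insert k I. b l * (x(k := y)) l * u' j ^ l)))"
    define B where "B = (\<lambda>x::nat \<Rightarrow> complex. \<Prod>j\<in>I. G (w j + (\<Sum>l\<in>I. b l * x l * u j ^ l)))"
    \<comment> \<open>the shear that removes the new coordinate \<open>y\<close> from the old factors\<close>
    define sh where "sh = (\<lambda>y l. - c l * (b k / b l) * y)"
    have fk: "(\<Sum>l\<in>insert k I. b l * (x(k := y)) l * z ^ l) = b k * y * z ^ k + (\<Sum>l\<in>I. b l * x l * z ^ l)" for x y z
    proof -
      have "(\<Sum>l\<in>I. b l * (x(k := y)) l * z ^ l) = (\<Sum>l\<in>I. b l * x l * z ^ l)"
        using insert.hyps by (intro sum.cong) auto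
      then show ?thesis using insert.hyps by simp
    qed
    have sheared: "(\<Sum>l\<in>I. b l * (\<lambda>l\<in>I. x l + sh y l) l * z ^ l) =
        (\<Sum>l\<in>I. b l * x l * z ^ l) - b k * y * (\<Sum>l\<in>I. c l * z ^ l)" for x y z
    proof -
      have "(\<Sum>l\<in>I. b l * (\<lambda>l\<in>I. x l + sh y l) l * z ^ l) = (\<Sum>l\<in>I. b l * x l * z ^ l - b k * y * (c l * z ^ l))"
        using b by (intro sum.cong) (auto simp: sh_def field_simps)
      then show ?thesis by (simp add: sum_subtractf sum_distrib_left)
    qed
    have AB: "A (\<lambda>l\<in>I. x l + sh y l) y = B x * G ((w k + (\<Sum>l\<in>I. b l * x l * v ^ l)) + (b k * p) * y)" for x y
    proof -
      have 1: "(\<Prod>j\<in>I. G (w j + (\<Sum>l\<in>insert k I. b l * ((\<lambda>l\<in>I. x l + sh y l)(k := y)) l * u' j ^ l))) = B x"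
        unfolding B_def fk sheared using c by (intro prod.cong) (auto simp: u'I)
      have 2: "w k + (\<Sum>l\<in>insert k I. b l * ((\<lambda>l\<in>I. x l + sh y l)(k := y)) l * u' k ^ l)
         = (w k + (\<Sum>l\<in>I. b l * x l * v ^ l)) + (b k * p) * y"
        unfolding fk sheared u'k p_def by (simp add: algebra_simps)
      show ?thesis unfolding A_def prod.insert[OF insert.hyps] 1 2 by (rule mult.commute)
    qed
    have [measurable]: "(\<lambda>x. B x) \<in> borel_measurable (PiM I (\<lambda>_. lborel))"
      unfolding B_def by measurable
    have A_meas: "(\<lambda>x. A x y) \<in> borel_measurable (PiM I (\<lambda>_. lborel))" for y
      unfolding A_def fk by measurable
    have A_meas2: "(\<lambda>(x, y). A x y) \<in> borel_measurable (PiM I (\<lambda>_. lborel) \<Otimes>\<^sub>M lborel)"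
      unfolding A_def fk by measurable
    interpret P: finite_product_sigma_finite "\<lambda>_::nat. lborel :: complex measure" I
      by standard (rule insert.hyps)
    interpret PS: pair_sigma_finite "PiM I (\<lambda>_::nat. lborel :: complex measure)" "lborel :: complex measure" ..
    have "(\<integral>\<^sup>+x. (\<Prod>j\<in>insert k I. G (w j + (\<Sum>l\<in>insert k I. b l * x l * u' j ^ l))) \<partial>PiM (insert k I) (\<lambda>_. lborel)) =
      (\<integral>\<^sup>+x. (\<integral>\<^sup>+y. A x y \<partial>lborel) \<partial>PiM I (\<lambda>_. lborel))"
      unfolding A_def by (rule product_nn_integral_insert[OF insert.hyps]) measurable
    also have "\<dots> = (\<integral>\<^sup>+y. (\<integral>\<^sup>+x. A x y \<partial>PiM I (\<lambda>_. lborel)) \<partial>lborel)"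
      by (rule PS.Fubini'[OF A_meas2, symmetric])
    also have "\<dots> = (\<integral>\<^sup>+y. (\<integral>\<^sup>+x. A (\<lambda>l\<in>I. x l + sh y l) y \<partial>PiM I (\<lambda>_. lborel)) \<partial>lborel)"
      by (subst nn_integral_PiM_translate[OF insert.hyps(1) A_meas]) simp
    also have "\<dots> = (\<integral>\<^sup>+y. (\<integral>\<^sup>+x. B x * G ((w k + (\<Sum>l\<in>I. b l * x l * v ^ l)) + (b k * p) * y) \<partial>PiM I (\<lambda>_. lborel)) \<partial>lborel)"
      unfolding AB ..
    also have "\<dots> = (\<integral>\<^sup>+x. (\<integral>\<^sup>+y. B x * G ((w k + (\<Sum>l\<in>I. b l * x l * v ^ l)) + (b k * p) * y) \<partial>lborel) \<partial>PiM I (\<lambda>_. lborel))"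
      by (rule PS.Fubini') measurable
    also have "\<dots> = (\<integral>\<^sup>+x. B x * (ennreal (inverse (cmod (b k * p) ^ 2)) * (\<integral>\<^sup>+z. G z \<partial>lborel)) \<partial>PiM I (\<lambda>_. lborel))"
      using b p0 by (intro nn_integral_cong) (simp add: nn_integral_cmult nn_integral_radial_affine[OF G rad])
    also have "\<dots> = (\<integral>\<^sup>+x. B x \<partial>PiM I (\<lambda>_. lborel)) * (ennreal (inverse (cmod (b k * p) ^ 2)) * (\<integral>\<^sup>+z. G z \<partial>lborel))"
      by (rule nn_integral_multc) measurable
    also have "\<dots> \<le> (ennreal (\<Prod>k\<in>I. inverse (cmod (b k) ^ 2)) * (\<integral>\<^sup>+z. G z \<partial>lborel) ^ card I) *
         (ennreal (inverse (cmod (b k) ^ 2)) * (\<integral>\<^sup>+z. G z \<partial>lborel))"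
    proof (intro mult_mono order_refl)
      show "(\<integral>\<^sup>+x. B x \<partial>PiM I (\<lambda>_. lborel)) \<le> ennreal (\<Prod>k\<in>I. inverse (cmod (b k) ^ 2)) * (\<integral>\<^sup>+z. G z \<partial>lborel) ^ card I"
        unfolding B_def using b by (intro contractingD[OF contr] G rad) auto
      have "cmod (b k) ^ 2 \<le> cmod (b k * p) ^ 2" 
        using p1 mult_left_mono[of 1 "cmod p" "cmod (b k)"] by (intro power_mono) (auto simp: norm_mult)
      then show "ennreal (inverse (cmod (b k * p) ^ 2)) \<le> ennreal (inverse (cmod (b k) ^ 2))"
        using b by (intro ennreal_leI le_imp_inverse_le) auto
    qed auto
    also have "\<dots> = ennreal (\<Prod>l\<in>insert k I. inverse (cmod (b l) ^ 2)) * (\<integral>\<^sup>+z. G z \<partial>lborel) ^ card (insert k I)"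
      using insert.hyps by (simp add: ennreal_mult prod_nonneg ac_simps)
    finally show ?thesis .
  qed
  have "interpolating (insert k I) u'" unfolding interpolating_def using solv' by blast
  moreover have "contracting (insert k I) u'" unfolding contracting_def using bound' by blast
  moreover have "\<forall>j\<in>insert k I. cmod (u' j) = 1" using u1 v(1) by (auto simp: u'I u'k)
  ultimately show ?case by blast
qed

section \<open>A truncated power of the modulus\<close>

text \<open>
  At \<open>0\<close> the value is \<open>0\<close>; the function is only compared with \<open>\<bar>f z\<bar> powr (d - 2)\<close> at points with
  \<open>f z \<noteq> 0\<close>.
\<close>

definition trunc_power :: "real \<Rightarrow> real \<Rightarrow> complex \<Rightarrow> ennreal" where
  "trunc_power d R w = (if w \<noteq> 0 \<and> cmod w \<le> R then ennreal (cmod w powr (d - 2)) else 0)"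

lemma trunc_power_measurable[measurable]: "trunc_power d R \<in> borel_measurable borel"
  unfolding trunc_power_def by measurable

lemma radial_trunc_power: "radial (trunc_power d R)"
  unfolding radial_def trunc_power_def by (metis norm_eq_zero)

text \<open>
  Compare with a constant on each of the shells between the radii \<open>R / 2 ^ Suc k\<close> and \<open>R / 2 ^ k\<close>; the contributions
  form a geometric series of ratio \<open>2 powr (- d)\<close>, whose sum is of order \<open>1 / d\<close>.
\<close>

lemma nn_integral_trunc_power_le:
  assumes d: "0 < d" "d \<le> 1" and R: "R > 0"
  shows "(\<integral>\<^sup>+w. trunc_power d R w \<partial>lborel) \<le> ennreal (12 * pi * R powr d / d)"
proof -
  define c where "c k = (R / 2 ^ Suc k) powr (d - 2)" for k :: nat
  define D where "D k = (cball 0 (R / 2 ^ k) :: complex set)" for k :: nat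
  define q where "q = 2 powr (-d)"
  have [measurable]: "D k \<in> sets borel" for k by (simp add: D_def)
  have q: "0 < q" "q < 1" using d by (auto simp: q_def powr_less_one)
  have pw: "trunc_power d R w \<le> (\<Sum>k. ennreal (c k) * indicator (D k) w)" for w
  proof (cases "w \<noteq> 0 \<and> cmod w \<le> R")
    case True
    define k where "k = (LEAST k. R / 2 ^ Suc k < cmod w)"
    have ex: "\<exists>k. R / 2 ^ Suc k < cmod w"
    proof -
      obtain n where "(1/2) ^ n < cmod w / R" using True R real_arch_pow_inv[of "cmod w / R" "1/2"] by auto
      then have "R / 2 ^ n < cmod w" using R by (simp add: field_simps power_divide)
      moreover have "R / 2 ^ Suc n \<le> R / 2 ^ n" using R by (simp add: field_simps)
      ultimately show ?thesis by (intro exI[of _ n]) linarith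
    qed
    have k1: "R / 2 ^ Suc k < cmod w" unfolding k_def by (rule LeastI_ex[OF ex])
    have k2: "cmod w \<le> R / 2 ^ k"
    proof (cases k)
      case 0 then show ?thesis using True by simp
    next
      case (Suc m)
      then have "\<not> (R / 2 ^ Suc m < cmod w)" unfolding k_def using not_less_Least[of m "\<lambda>k. R / 2 ^ Suc k < cmod w"] by simp
      then show ?thesis using Suc by simp
    qed
    have "cmod w powr (d - 2) \<le> c k" unfolding c_def using k1 R d
      by (intro powr_mono2') auto
    then have "trunc_power d R w \<le> ennreal (c k) * indicator (D k) w"
      using True k2 by (auto simp: trunc_power_def D_def intro: ennreal_leI)
    also have "\<dots> \<le> (\<Sum>k. ennreal (c k) * indicator (D k) w)"
      using sum_le_suminf[of "\<lambda>k. ennreal (c k) * indicator (D k) w" "{k}"] by (simp del: sum_mult_indicator)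
    finally show ?thesis .
  qed (auto simp: trunc_power_def)
  have shell: "ennreal (c k) * emeasure lborel (D k) = ennreal (pi * R powr d * 2 powr (2 - d) * q ^ k)" for k
  proof -
    have "ennreal (c k) * emeasure lborel (D k) = ennreal (c k * (pi * (R / 2 ^ k)\<^sup>2))"
      unfolding D_def using R by (simp add: emeasure_cball unit_ball_vol_numeral fact_numeral ennreal_mult[symmetric] c_def)
    also have "c k * (pi * (R / 2 ^ k)\<^sup>2) = pi * R powr d * 2 powr (2 - d) * q ^ k"
    proof -
      have inv: "(2 powr real (Suc k)) powr (2 - d) = inverse ((2 powr real (Suc k)) powr (d - 2))"
        by (simp only: powr_minus[symmetric] minus_diff_eq)
      have "c k = R powr (d - 2) / (2 powr real (Suc k)) powr (d - 2)"
        unfolding c_def using R by (simp only: powr_realpow[of 2 "Suc k"] powr_divide)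
      then have "c k = R powr (d - 2) * (2 powr real (Suc k)) powr (2 - d)"
        by (simp only: inv divide_inverse)
      also have "((2::real) powr real (Suc k)) powr (2 - d) = 2 powr (real k * (2 - d)) * 2 powr (2 - d)"
        by (simp only: powr_powr powr_add[symmetric]) (simp add: algebra_simps)
      finally have ck: "c k = R powr (d - 2) * (2 powr (real k * (2 - d)) * 2 powr (2 - d))" .
      have "(R / 2 ^ k)\<^sup>2 = R powr 2 * 2 powr (- 2 * real k)"
      proof -
        have "2 powr (- 2 * real k) = 2 powr (- real (2 * k))" by simp
        also have "\<dots> = inverse (2 ^ (2 * k))" unfolding powr_minus by (rule arg_cong[of _ _ inverse], rule powr_realpow) simp
        finally have "2 powr (- 2 * real k) = inverse ((2 ^ k)\<^sup>2)" by (simp add: power_mult[symmetric] mult.commute)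
        moreover have "R powr 2 = R\<^sup>2" using R by simp
        ultimately show ?thesis by (simp only: divide_inverse power_mult_distrib power_inverse)
      qed
      then have "c k * (pi * (R / 2 ^ k)\<^sup>2) = pi * (R powr (d - 2) * R powr 2) * 2 powr (2 - d) * (2 powr (real k * (2 - d)) * 2 powr (- 2 * real k))"
        by (simp add: ck)
      also have "\<dots> = pi * R powr d * 2 powr (2 - d) * 2 powr (- d * real k)"
        by (simp only: powr_add[symmetric]) (simp add: algebra_simps)
      also have "2 powr (- d * real k) = q ^ k" by (simp add: q_def powr_power mult.commute)
      finally show ?thesis .
    qed
    finally show ?thesis .
  qed
  have "(\<integral>\<^sup>+w. trunc_power d R w \<partial>lborel) \<le> (\<integral>\<^sup>+w. (\<Sum>k. ennreal (c k) * indicator (D k) w) \<partial>lborel)"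
    by (intro nn_integral_mono pw)
  also have "\<dots> = (\<Sum>k. \<integral>\<^sup>+w. ennreal (c k) * indicator (D k) w \<partial>lborel)"
    by (rule nn_integral_suminf) measurable
  also have "\<dots> = (\<Sum>k. ennreal (pi * R powr d * 2 powr (2 - d) * q ^ k))"
    by (simp add: nn_integral_cmult_indicator shell)
  also have "\<dots> = ennreal (\<Sum>k. pi * R powr d * 2 powr (2 - d) * q ^ k)"
    using q by (intro suminf_ennreal2 summable_mult summable_geometric) auto
  also have "(\<Sum>k. pi * R powr d * 2 powr (2 - d) * q ^ k) = pi * R powr d * 2 powr (2 - d) * (1 / (1 - q))"
    using q by (subst suminf_mult) (auto simp: suminf_geometric intro: summable_geometric)
  also have "\<dots> \<le> pi * R powr d * 4 * (3 / d)"
  proof (intro mult_mono)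
    have "(2::real) powr (2 - d) \<le> 2 powr 2" using d by (intro powr_mono) auto
    then show "(2::real) powr (2 - d) \<le> 4" by simp
    have "ln 2 > (1/2::real)" using ln_2_less_1 ln2_ge_two_thirds by simp
    then have "1 + d / 2 \<le> 1 + d * ln 2" using d by simp
    also have "\<dots> \<le> exp (d * ln 2)" by (rule exp_ge_add_one_self)
    also have "\<dots> = 1 / q" by (simp add: q_def powr_def exp_minus field_simps)
    finally have "q * (1 + d / 2) \<le> 1" using q by (simp add: field_simps)
    then have "d / 3 \<le> 1 - q"
    proof -
      have "q \<le> 1 / (1 + d/2)" using \<open>q * (1 + d / 2) \<le> 1\<close> d by (simp add: field_simps)
      also have "\<dots> \<le> 1 - d / 3" using d by (simp add: field_simps power2_eq_square)
      finally show ?thesis by simp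
    qed
    then show "1 / (1 - q) \<le> 3 / d" using d q by (simp add: field_simps)
  qed (use q d in auto)
  finally show ?thesis using d by (simp add: ennreal_leI mult_ac)
qed

section \<open>The mean value inequality for zero-free functions\<close>

lemma circle_mean_value:
  assumes H: "H holomorphic_on ball 0 r" and \<rho>: "0 < \<rho>" "\<rho> < r"
  shows "((\<lambda>t. H (of_real \<rho> * cis (2 * pi * t))) has_integral H 0) {0..1}"
proof -
  have "((\<lambda>u. H u / (u - 0)) has_contour_integral (2 * of_real pi * \<i> * H 0)) (circlepath 0 \<rho>)"
    using \<rho> by (intro Cauchy_integral_circlepath holomorphic_on_imp_continuous_on holomorphic_on_subset[OF H])
      auto
  then have "((\<lambda>t. 2 * of_real pi * \<i> * H (of_real \<rho> * cis (2 * pi * t))) has_integral (2 * of_real pi * \<i> * H 0)) {0..1}"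
    unfolding has_contour_integral_def
  proof (rule has_integral_eq[rotated])
    fix t :: real assume "t \<in> {0..1}"
    then have "vector_derivative (circlepath 0 \<rho>) (at t within {0..1}) = 2 * of_real pi * \<i> * (of_real \<rho> * cis (2 * pi * t))"
      by (subst vector_derivative_circlepath01) (auto simp: cis_conv_exp field_simps)
    moreover have "circlepath 0 \<rho> t = of_real \<rho> * cis (2 * pi * t)"
      by (simp add: circlepath cis_conv_exp field_simps)
    ultimately show "H (circlepath 0 \<rho> t) / (circlepath 0 \<rho> t - 0) * vector_derivative (circlepath 0 \<rho>) (at t within {0..1}) =
       2 * of_real pi * \<i> * H (of_real \<rho> * cis (2 * pi * t))" using \<rho> by simp
  qed
  note int = this
  have inv: "inverse (2 * of_real pi * \<i>) * (2 * of_real pi * \<i> * x) = x" for x :: complex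
    by (simp add: field_simps)
  show ?thesis
    using has_integral_mult_right[OF int, of "inverse (2 * of_real pi * \<i>)"] unfolding inv .
qed

text \<open>
  With a holomorphic logarithm \<open>g\<close> of \<open>f\<close>, the function \<open>H z = exp (- s * (\<Sum>j\<in>I. g (z * u j)))\<close> is holomorphic,
  and the inequality is \<open>\<bar>H 0\<bar> \<le> average of \<bar>H\<bar>\<close> on the circle of radius \<open>\<rho>\<close>.
\<close>

lemma zero_free_mean_inequality:
  fixes u :: "nat \<Rightarrow> complex"
  assumes f: "f holomorphic_on ball 0 r" and nz: "\<And>z. cmod z < r \<Longrightarrow> f z \<noteq> 0"
    and \<rho>: "0 < \<rho>" "\<rho> < r" and I: "finite I" and u: "\<And>j. j \<in> I \<Longrightarrow> cmod (u j) = 1"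
  shows "ennreal (cmod (f 0) powr (- s)) ^ card I \<le>
     (\<integral>\<^sup>+t\<in>{0..1}. (\<Prod>j\<in>I. ennreal (cmod (f (of_real \<rho> * cis (2 * pi * t) * u j)) powr (- s))) \<partial>lborel)"
proof -
  obtain g where g: "g holomorphic_on ball 0 r" and fg: "\<And>z. z \<in> ball 0 r \<Longrightarrow> f z = exp (g z)"
    using contractible_imp_holomorphic_log[OF f] nz by (metis convex_ball convex_imp_contractible mem_ball_0)
  define H where "H z = exp (- of_real s * (\<Sum>j\<in>I. g (z * u j)))" for z
  have ball: "z * u j \<in> ball 0 r" if "z \<in> ball 0 r" "j \<in> I" for z j
    using that u by (simp add: norm_mult)
  have "(\<lambda>z. g (z * u j)) holomorphic_on ball 0 r" if "j \<in> I" for j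
    by (rule holomorphic_on_compose_gen[OF _ g, unfolded o_def]) (use ball that in \<open>auto intro!: holomorphic_intros\<close>)
  then have H: "H holomorphic_on ball 0 r" unfolding H_def by (intro holomorphic_intros) auto
  have nH: "cmod (H z) = (\<Prod>j\<in>I. cmod (f (z * u j)) powr (- s))" if "z \<in> ball 0 r" for z
  proof -
    have "cmod (H z) = exp (\<Sum>j\<in>I. - s * Re (g (z * u j)))"
      by (simp add: H_def sum_distrib_left)
    also have "\<dots> = (\<Prod>j\<in>I. exp (- s * Re (g (z * u j))))" by (rule exp_sum[OF I])
    also have "\<dots> = (\<Prod>j\<in>I. cmod (f (z * u j)) powr (- s))"
      using ball that by (intro prod.cong refl) (simp add: fg powr_def)
    finally show ?thesis .
  qed
  have "((\<lambda>t. H (of_real \<rho> * cis (2 * pi * t))) has_integral H 0) {0..1}"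
    by (rule circle_mean_value[OF H \<rho>])
  moreover have inb: "of_real \<rho> * cis (2 * pi * t) \<in> ball 0 r" for t using \<rho> by (simp add: norm_mult)
  have cont: "continuous_on {0..1} (\<lambda>t. H (of_real \<rho> * cis (2 * pi * t)))"
    by (intro continuous_on_compose2[OF holomorphic_on_imp_continuous_on[OF H]] continuous_intros) (use inb in auto)
  then have contn: "continuous_on {0..1} (\<lambda>t. cmod (H (of_real \<rho> * cis (2 * pi * t))))"
    by (intro continuous_intros)
  ultimately have "cmod (H 0) \<le> integral {0..1} (\<lambda>t. cmod (H (of_real \<rho> * cis (2 * pi * t))))"
    using integral_norm_bound_integral[of "\<lambda>t. H (of_real \<rho> * cis (2 * pi * t))" "{0..1}" "\<lambda>t. cmod (H (of_real \<rho> * cis (2 * pi * t)))"]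
    by (auto simp: integrable_continuous_interval integral_unique)
  also have "integral {0..1} (\<lambda>t. cmod (H (of_real \<rho> * cis (2 * pi * t)))) =
      (LINT t:{0..1}|lborel. cmod (H (of_real \<rho> * cis (2 * pi * t))))"
    using set_borel_integral_eq_integral(2)[OF borel_integrable_atLeastAtMost'[OF contn]] by simp
  finally have "ennreal (cmod (H 0)) \<le> ennreal (LINT t:{0..1}|lborel. cmod (H (of_real \<rho> * cis (2 * pi * t))))"
    by (rule ennreal_leI)
  also have "\<dots> = (\<integral>\<^sup>+t\<in>{0..1}. ennreal (cmod (H (of_real \<rho> * cis (2 * pi * t)))) \<partial>lborel)"
    unfolding set_lebesgue_integral_def
    by (subst nn_integral_eq_integral[symmetric])
      (use borel_integrable_atLeastAtMost'[OF contn] in \<open>auto simp: set_integrable_def indicator_def intro!: nn_integral_cong\<close>)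
  also have "\<dots> = (\<integral>\<^sup>+t\<in>{0..1}. (\<Prod>j\<in>I. ennreal (cmod (f (of_real \<rho> * cis (2 * pi * t) * u j)) powr (- s))) \<partial>lborel)"
    unfolding nH[OF inb] by (simp add: prod_ennreal)
  also have "ennreal (cmod (H 0)) = ennreal (cmod (f 0) powr (- s)) ^ card I"
    using \<rho> by (subst nH) (auto simp: ennreal_power)
  finally show ?thesis .
qed

section \<open>Independent complex Gaussian variables\<close>

lemma nn_integral_PiM_density_le:
  fixes N :: "'i \<Rightarrow> complex measure" and h :: "('i \<Rightarrow> complex) \<Rightarrow> ennreal"
  assumes "finite I" and p: "\<And>i. prob_space (N i)"
    and N: "\<And>i. N i = density lborel (d i)" and d[measurable]: "\<And>i. d i \<in> borel_measurable borel" and le: "\<And>i z. d i z \<le> c"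
    and "h \<in> borel_measurable (PiM I (\<lambda>_. borel))"
  shows "(\<integral>\<^sup>+x. h x \<partial>PiM I N) \<le> c ^ card I * (\<integral>\<^sup>+x. h x \<partial>PiM I (\<lambda>_. lborel))"
  using assms(1) assms(6)
proof (induction I arbitrary: h rule: finite_induct)
  case empty
  then show ?case by (simp add: PiM_empty nn_integral_count_space_finite)
next
  case (insert k I)
  interpret L: product_sigma_finite "\<lambda>_::'i. lborel :: complex measure" by (rule lborel_product_sigma_finite)
  interpret N: prob_space "N i" for i by (rule p)
  interpret N: product_sigma_finite N ..
  have sN[measurable_cong]: "sets (N i) = sets borel" for i by (simp add: N)
  note [measurable] = insert.prems
  have [measurable]: "h \<in> borel_measurable (PiM (insert k I) N)" by measurable
  have [measurable]: "h \<in> borel_measurable (PiM (insert k I) (\<lambda>_. lborel))" by measurable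
  have hm: "(\<lambda>y. h (x(k := y))) \<in> borel_measurable borel" if "x \<in> space (PiM I N)" for x
  proof -
    have "(\<lambda>y. (x(k := y))) \<in> measurable borel (PiM (insert k I) N)"
      using that by measurable
    then show ?thesis using measurable_compose[of _ borel _ h] by simp
  qed
  have "(\<integral>\<^sup>+x. h x \<partial>PiM (insert k I) N) = (\<integral>\<^sup>+x. (\<integral>\<^sup>+y. h (x(k := y)) \<partial>N k) \<partial>PiM I N)"
    by (rule N.product_nn_integral_insert[OF insert.hyps]) measurable
  also have "\<dots> \<le> (\<integral>\<^sup>+x. c * (\<integral>\<^sup>+y. h (x(k := y)) \<partial>lborel) \<partial>PiM I N)"
  proof (rule nn_integral_mono)
    fix x assume x: "x \<in> space (PiM I N)"
    note [measurable] = hm[OF x]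
    have "(\<integral>\<^sup>+y. h (x(k := y)) \<partial>N k) = (\<integral>\<^sup>+y. d k y * h (x(k := y)) \<partial>lborel)"
      unfolding N by (rule nn_integral_density) measurable
    also have "\<dots> \<le> (\<integral>\<^sup>+y. c * h (x(k := y)) \<partial>lborel)"
      by (intro nn_integral_mono mult_right_mono le) simp
    also have "\<dots> = c * (\<integral>\<^sup>+y. h (x(k := y)) \<partial>lborel)"
      by (rule nn_integral_cmult) measurable
    finally show "(\<integral>\<^sup>+y. h (x(k := y)) \<partial>N k) \<le> c * (\<integral>\<^sup>+y. h (x(k := y)) \<partial>lborel)" .
  qed
  also have "\<dots> \<le> c ^ card I * (\<integral>\<^sup>+x. c * (\<integral>\<^sup>+y. h (x(k := y)) \<partial>lborel) \<partial>PiM I (\<lambda>_. lborel))"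
    by (rule insert.IH) measurable
  also have "\<dots> = c ^ card I * (c * (\<integral>\<^sup>+x. (\<integral>\<^sup>+y. h (x(k := y)) \<partial>lborel) \<partial>PiM I (\<lambda>_. lborel)))"
    by (subst nn_integral_cmult) measurable
  also have "(\<integral>\<^sup>+x. (\<integral>\<^sup>+y. h (x(k := y)) \<partial>lborel) \<partial>PiM I (\<lambda>_. lborel)) = (\<integral>\<^sup>+x. h x \<partial>PiM (insert k I) (\<lambda>_. lborel))"
    by (rule L.product_nn_integral_insert[OF insert.hyps, symmetric]) measurable
  finally show ?case using insert.hyps by (simp add: ac_simps)
qed

locale iid_gaussians = prob_space M for M :: "'w measure" +
  fixes \<xi> :: "nat \<Rightarrow> 'w \<Rightarrow> complex"
  assumes indep: "indep_vars (\<lambda>_. borel) \<xi> UNIV"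
    and dist: "\<And>n. distributed M lborel (\<xi> n) (\<lambda>z. ennreal (std_complex_gaussian_density z))"
begin

lemma rv[measurable]: "\<xi> n \<in> borel_measurable M"
  using dist[of n] by (simp add: distributed_def)

lemma density_measurable[measurable]: "std_complex_gaussian_density \<in> borel_measurable borel"
  unfolding std_complex_gaussian_density_def by measurable

lemma nn_integral_\<xi>:
  assumes [measurable]: "g \<in> borel_measurable borel"
  shows "(\<integral>\<^sup>+\<omega>. g (\<xi> n \<omega>) \<partial>M) = (\<integral>\<^sup>+z. ennreal (std_complex_gaussian_density z) * g z \<partial>lborel)"
  by (rule distributed_nn_integral[OF dist, symmetric]) simp

text \<open>
  Dilating by \<open>sqrt 2\<close> turns the integral into twice that of the density of \<open>\<xi> n\<close>, hence into \<open>2\<close>.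
\<close>

lemma nn_integral_exp_half_sq:
  "(\<integral>\<^sup>+\<omega>. ennreal (exp ((cmod (\<xi> n \<omega>))\<^sup>2 / 2)) \<partial>M) = 2"
proof -
  have "(\<integral>\<^sup>+\<omega>. ennreal (exp ((cmod (\<xi> n \<omega>))\<^sup>2 / 2)) \<partial>M) =
     (\<integral>\<^sup>+z. ennreal (exp (- (cmod z)\<^sup>2 / 2) / pi) \<partial>lborel)"
    by (subst nn_integral_\<xi>)
      (auto simp: std_complex_gaussian_density_def ennreal_mult[symmetric] exp_add[symmetric] intro!: nn_integral_cong)
  also have "\<dots> = ennreal 2 * (\<integral>\<^sup>+z. ennreal (exp (- (cmod z)\<^sup>2) / pi) \<partial>lborel)"
    by (subst nn_integral_lborel_scale[where c="sqrt 2"]) (auto simp: power_mult_distrib)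
  also have "(\<integral>\<^sup>+z. ennreal (exp (- (cmod z)\<^sup>2) / pi) \<partial>lborel) = (\<integral>\<^sup>+\<omega>. 1 \<partial>M)"
    by (subst nn_integral_\<xi>[where g="\<lambda>_. 1"]) (auto simp: std_complex_gaussian_density_def)
  finally show ?thesis by (simp add: emeasure_space_1)
qed

lemma tail: "prob {\<omega>\<in>space M. cmod (\<xi> n \<omega>) > y} \<le> 2 * exp (- y\<^sup>2 / 2)" if "y \<ge> 0"
proof -
  have "emeasure M {\<omega>\<in>space M. cmod (\<xi> n \<omega>) > y} \<le>
     emeasure M ({\<omega>\<in>space M. 1 \<le> ennreal (exp (- y\<^sup>2 / 2)) * ennreal (exp ((cmod (\<xi> n \<omega>))\<^sup>2 / 2))})"
  proof (rule emeasure_mono)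
    show "{\<omega> \<in> space M. y < cmod (\<xi> n \<omega>)} \<subseteq>
      {\<omega> \<in> space M. 1 \<le> ennreal (exp (- y\<^sup>2 / 2)) * ennreal (exp ((cmod (\<xi> n \<omega>))\<^sup>2 / 2))}"
    proof safe
      fix \<omega> assume "y < cmod (\<xi> n \<omega>)"
      then have "y\<^sup>2 \<le> (cmod (\<xi> n \<omega>))\<^sup>2" using that by (intro power_mono) auto
      then have "1 \<le> exp (- y\<^sup>2 / 2) * exp ((cmod (\<xi> n \<omega>))\<^sup>2 / 2)"
        by (simp add: exp_add[symmetric])
      then show "1 \<le> ennreal (exp (- y\<^sup>2 / 2)) * ennreal (exp ((cmod (\<xi> n \<omega>))\<^sup>2 / 2))"
        by (subst ennreal_mult[symmetric]) (auto simp: ennreal_le_iff[symmetric] simp del: ennreal_le_iff ennreal_1 simp flip: ennreal_1)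
    qed
  qed measurable
  also have "\<dots> \<le> ennreal (exp (- y\<^sup>2 / 2)) * (\<integral>\<^sup>+\<omega>. ennreal (exp ((cmod (\<xi> n \<omega>))\<^sup>2 / 2)) * indicator (space M) \<omega> \<partial>M)"
    by (rule nn_integral_Markov_inequality) measurable
  also have "(\<integral>\<^sup>+\<omega>. ennreal (exp ((cmod (\<xi> n \<omega>))\<^sup>2 / 2)) * indicator (space M) \<omega> \<partial>M) = 2"
    using nn_integral_exp_half_sq[of n] by (simp cong: nn_integral_cong)
  also have "ennreal (exp (- y\<^sup>2 / 2)) * 2 = ennreal (2 * exp (- y\<^sup>2 / 2))"
    by (simp add: ennreal_mult'' mult.commute)
  finally show ?thesis by (simp add: emeasure_eq_measure)
qed

lemma mean_cmod_le: "(\<integral>\<^sup>+\<omega>. ennreal (cmod (\<xi> n \<omega>)) \<partial>M) \<le> 2"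
proof -
  have "x \<le> exp (x\<^sup>2 / 2)" for x :: real
  proof -
    have "0 \<le> (x - 1)\<^sup>2" by simp
    then have "x \<le> 1 + x\<^sup>2 / 2" by (simp add: power2_eq_square algebra_simps)
    also have "\<dots> \<le> exp (x\<^sup>2 / 2)" by (rule exp_ge_add_one_self)
    finally show ?thesis .
  qed
  then have "(\<integral>\<^sup>+\<omega>. ennreal (cmod (\<xi> n \<omega>)) \<partial>M) \<le> (\<integral>\<^sup>+\<omega>. ennreal (exp ((cmod (\<xi> n \<omega>))\<^sup>2 / 2)) \<partial>M)"
    by (intro nn_integral_mono ennreal_leI)
  then show ?thesis by (simp add: nn_integral_exp_half_sq)
qed

lemma prob_cball_ge:
  assumes "\<rho> \<ge> 0" and m: "\<And>z. z \<in> cball c \<rho> \<Longrightarrow> cmod z \<le> m"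
  shows "prob {\<omega>\<in>space M. \<xi> n \<omega> \<in> cball c \<rho>} \<ge> exp (- m\<^sup>2) * \<rho>\<^sup>2"
proof -
  have [measurable]: "cball c \<rho> \<in> sets borel" by simp
  have "ennreal (exp (- m\<^sup>2) * \<rho>\<^sup>2) = ennreal (exp (- m\<^sup>2) / pi) * emeasure lborel (cball c \<rho>)"
    using assms(1) by (simp add: emeasure_cball unit_ball_vol_numeral fact_numeral ennreal_mult[symmetric])
  also have "\<dots> = (\<integral>\<^sup>+z. ennreal (exp (- m\<^sup>2) / pi) * indicator (cball c \<rho>) z \<partial>lborel)"
    by (subst nn_integral_cmult_indicator) auto
  also have "\<dots> \<le> (\<integral>\<^sup>+z. ennreal (std_complex_gaussian_density z) * indicator (cball c \<rho>) z \<partial>lborel)"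
  proof (intro nn_integral_mono)
    fix z
    have "exp (- m\<^sup>2) / pi \<le> std_complex_gaussian_density z" if "z \<in> cball c \<rho>"
      using m[OF that] power_mono[of "cmod z" m 2] unfolding std_complex_gaussian_density_def
      by (intro divide_right_mono) auto
    then show "ennreal (exp (- m\<^sup>2) / pi) * indicator (cball c \<rho>) z \<le> ennreal (std_complex_gaussian_density z) * indicator (cball c \<rho>) z"
      by (auto simp: indicator_def intro: ennreal_leI)
  qed
  also have "\<dots> = (\<integral>\<^sup>+\<omega>. indicator (cball c \<rho>) (\<xi> n \<omega>) \<partial>M)"
    by (rule nn_integral_\<xi>[symmetric]) (simp add: borel_measurable_indicator)
  also have "\<dots> = (\<integral>\<^sup>+\<omega>. indicator {\<omega>\<in>space M. \<xi> n \<omega> \<in> cball c \<rho>} \<omega> \<partial>M)"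
    by (intro nn_integral_cong) (auto simp: indicator_def)
  also have "\<dots> = emeasure M {\<omega>\<in>space M. \<xi> n \<omega> \<in> cball c \<rho>}"
    by (rule nn_integral_indicator) measurable
  finally show ?thesis by (simp add: emeasure_eq_measure)
qed

lemma prob_small: "prob {\<omega>\<in>space M. cmod (\<xi> n \<omega>) \<le> x} \<ge> exp (- 1) * x\<^sup>2" if "0 \<le> x" "x \<le> 1"
  using prob_cball_ge[of x 0 1 n] that by auto

lemma prob_large: "prob {\<omega>\<in>space M. cmod (\<xi> n \<omega>) \<ge> K} \<ge> exp (- (K + 2)\<^sup>2)" if "K \<ge> 0"
proof -
  let ?c = "of_real (K + 1) :: complex"
  have "exp (- (K + 2)\<^sup>2) * 1\<^sup>2 \<le> prob {\<omega>\<in>space M. \<xi> n \<omega> \<in> cball ?c 1}"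
  proof (rule prob_cball_ge)
    fix z assume "z \<in> cball ?c 1"
    then show "cmod z \<le> K + 2" using norm_triangle_ineq2[of z ?c] that by (simp add: dist_norm norm_minus_commute del: of_real_add)
  qed simp
  also have "\<dots> \<le> prob {\<omega>\<in>space M. cmod (\<xi> n \<omega>) \<ge> K}"
  proof (rule finite_measure_mono)
    show "{\<omega> \<in> space M. \<xi> n \<omega> \<in> cball ?c 1} \<subseteq> {\<omega> \<in> space M. K \<le> cmod (\<xi> n \<omega>)}"
      using that by (auto simp: dist_norm simp del: of_real_add)
        (smt (verit) norm_of_real norm_triangle_ineq2)
  qed measurable
  finally show ?thesis by simp
qed

lemma AE_nonzero: "AE \<omega> in M. \<xi> n \<omega> \<noteq> 0"
proof -
  have "emeasure M {\<omega>\<in>space M. \<xi> n \<omega> = 0} = (\<integral>\<^sup>+\<omega>. indicator {0} (\<xi> n \<omega>) \<partial>M)"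
    by (subst nn_integral_indicator[symmetric]) (measurable, intro nn_integral_cong, simp add: indicator_def)
  also have "\<dots> = (\<integral>\<^sup>+z. ennreal (std_complex_gaussian_density z) * indicator {0} z \<partial>lborel)"
    by (rule nn_integral_\<xi>) (simp add: borel_measurable_indicator)
  also have "\<dots> = (\<integral>\<^sup>+z. 0 \<partial>(lborel :: complex measure))"
  proof (rule nn_integral_cong_AE)
    have "AE z::complex in lborel. z \<noteq> 0"
      by (rule AE_I[of _ _ "{0}"]) auto
    then show "AE z in lborel. ennreal (std_complex_gaussian_density z) * indicator {0} z = 0" by eventually_elim auto
  qed
  finally show ?thesis by (intro AE_I[of _ _ "{\<omega>\<in>space M. \<xi> n \<omega> = 0}"]) auto
qed

text \<open>
  Fubini for the independent blocks \<open>I\<close> and \<open>- I\<close>: with the block \<open>- I\<close> frozen, the Gaussian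
  density on the block \<open>I\<close> is replaced by its maximum \<open>1 / pi\<close> per coordinate.
\<close>

lemma nn_integral_split_le:
  fixes \<Psi> :: "(nat \<Rightarrow> complex) \<Rightarrow> (nat \<Rightarrow> complex) \<Rightarrow> ennreal"
  assumes fin: "finite I"
    and \<Psi>[measurable]: "(\<lambda>(x, y). \<Psi> x y) \<in> borel_measurable (PiM I (\<lambda>_. borel) \<Otimes>\<^sub>M PiM (- I) (\<lambda>_. borel))"
    and le: "\<And>y. y \<in> space (PiM (- I) (\<lambda>_. borel)) \<Longrightarrow> (\<integral>\<^sup>+x. \<Psi> x y \<partial>PiM I (\<lambda>_. lborel)) \<le> K"
  shows "(\<integral>\<^sup>+\<omega>. \<Psi> (\<lambda>i\<in>I. \<xi> i \<omega>) (\<lambda>i\<in>-I. \<xi> i \<omega>) \<partial>M) \<le> ennreal (1 / pi) ^ card I * K"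
proof -
  let ?X = "\<lambda>\<omega>. \<lambda>i\<in>I. \<xi> i \<omega>" and ?Y = "\<lambda>\<omega>. \<lambda>i\<in>-I. \<xi> i \<omega>"
  let ?P = "PiM I (\<lambda>_. borel :: complex measure)" and ?Q = "PiM (-I) (\<lambda>_. borel :: complex measure)"
  have "indep_var ?P ?X ?Q ?Y"
    by (rule indep_var_restrict[OF indep]) auto
  then have rX[measurable]: "?X \<in> measurable M ?P" and rY[measurable]: "?Y \<in> measurable M ?Q"
    and XY: "distr M ?P ?X \<Otimes>\<^sub>M distr M ?Q ?Y = distr M (?P \<Otimes>\<^sub>M ?Q) (\<lambda>\<omega>. (?X \<omega>, ?Y \<omega>))"
    unfolding indep_var_distribution_eq by auto
  interpret PX: prob_space "distr M ?P ?X" by (rule prob_space_distr) simp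
  interpret PY: prob_space "distr M ?Q ?Y" by (rule prob_space_distr) simp
  interpret PP: pair_sigma_finite "distr M ?P ?X" "distr M ?Q ?Y" ..
  have inner: "(\<integral>\<^sup>+x. \<Psi> x y \<partial>distr M ?P ?X) \<le> ennreal (1 / pi) ^ card I * K" if y: "y \<in> space ?Q" for y
  proof -
    have [measurable]: "(\<lambda>x. \<Psi> x y) \<in> borel_measurable ?P" using y by measurable
    have distr: "distr M ?P ?X = PiM I (\<lambda>i. distr M borel (\<xi> i))"
    proof (cases "I = {}")
      case True
      have "distr M ?P ?X = ?P"
        unfolding True PiM_empty
        by (rule measure_eqI)
          (auto simp: emeasure_distr emeasure_space_1 restrict_def PiM_empty indicator_def subset_singleton_iff)
      then show ?thesis by (simp add: True PiM_empty)
    next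
      case False
      then show ?thesis
        using indep_vars_iff_distr_eq_PiM'[OF False, of \<xi> "\<lambda>_. borel"] indep_vars_subset[OF indep, of I] by simp
    qed
    have "(\<integral>\<^sup>+x. \<Psi> x y \<partial>distr M ?P ?X) \<le> ennreal (1 / pi) ^ card I * (\<integral>\<^sup>+x. \<Psi> x y \<partial>PiM I (\<lambda>_. lborel))"
      unfolding distr
    proof (rule nn_integral_PiM_density_le[OF fin, where d="\<lambda>_ z. ennreal (std_complex_gaussian_density z)"])
      show "prob_space (distr M borel (\<xi> i))" for i by (rule prob_space_distr) simp
      show "distr M borel (\<xi> i) = density lborel (\<lambda>z. ennreal (std_complex_gaussian_density z))" for i
        using dist[of i] unfolding distributed_def by (metis distr_cong sets_lborel)
      show "ennreal (std_complex_gaussian_density z) \<le> ennreal (1 / pi)" for z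
        unfolding std_complex_gaussian_density_def by (intro ennreal_leI divide_right_mono) auto
    qed auto
    also have "\<dots> \<le> ennreal (1 / pi) ^ card I * K" by (intro mult_left_mono le y) auto
    finally show ?thesis .
  qed
  have "(\<integral>\<^sup>+\<omega>. \<Psi> (?X \<omega>) (?Y \<omega>) \<partial>M) = (\<integral>\<^sup>+p. \<Psi> (fst p) (snd p) \<partial>distr M (?P \<Otimes>\<^sub>M ?Q) (\<lambda>\<omega>. (?X \<omega>, ?Y \<omega>)))"
    by (subst nn_integral_distr) auto
  also have "\<dots> = (\<integral>\<^sup>+y. (\<integral>\<^sup>+x. \<Psi> x y \<partial>distr M ?P ?X) \<partial>distr M ?Q ?Y)"
    unfolding XY[symmetric] by (subst PP.nn_integral_snd[symmetric]) auto
  also have "\<dots> \<le> (\<integral>\<^sup>+y. ennreal (1 / pi) ^ card I * K \<partial>distr M ?Q ?Y)"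
    by (intro nn_integral_mono inner) simp
  also have "\<dots> = ennreal (1 / pi) ^ card I * K"
    using PY.emeasure_space_1 by simp
  finally show ?thesis .
qed

end

lemma iid_gaussiansI: "iid_std_complex_gaussian M \<xi> \<Longrightarrow> iid_gaussians M \<xi>"
  by (simp add: iid_std_complex_gaussian_def iid_gaussians_def iid_gaussians_axioms_def)

section \<open>Rapidly decaying coefficients\<close>

text \<open>
  The decay condition in the form in which it is used: the power series with coefficients \<open>a\<close> has
  infinite radius of convergence.
\<close>

locale rapid_coeffs =
  fixes a :: "nat \<Rightarrow> real"
  assumes nonneg: "\<And>n. a n \<ge> 0" and a0: "a 0 > 0"
    and rapid: "\<And>R. R > 0 \<Longrightarrow> \<forall>\<^sub>F n in sequentially. a n * R ^ n \<le> 1"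
begin

definition active :: "real \<Rightarrow> nat set" where
  "active r = {k. a k * r ^ k > 1}"

lemma finite_active: "r > 0 \<Longrightarrow> finite (active r)"
  using rapid[of r] unfolding active_def eventually_cofinite[symmetric] cofinite_eq_sequentially[symmetric]
  by (simp add: eventually_cofinite not_le)

lemma summable_coeffs: "r \<ge> 0 \<Longrightarrow> summable (\<lambda>n. a n * r ^ n)"
proof -
  assume r: "r \<ge> 0"
  have "\<forall>\<^sub>F n in sequentially. a n * (2 * (r + 1)) ^ n \<le> 1"
    using r by (intro rapid) auto
  then have "\<forall>\<^sub>F n in sequentially. a n * r ^ n \<le> (1/2) ^ n"
  proof (eventually_elim)
    case (elim n)
    have "a n * r ^ n \<le> a n * (r + 1) ^ n" using r by (intro mult_left_mono power_mono nonneg) auto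
    also have "\<dots> = (a n * (2 * (r + 1)) ^ n) * (1/2) ^ n"
      unfolding power_mult_distrib[of 2 "r + 1"] by (simp add: power_divide)
    also have "\<dots> \<le> 1 * (1/2) ^ n" using elim r by (intro mult_right_mono) auto
    finally show ?case by simp
  qed
  then have "\<forall>\<^sub>F n in sequentially. norm (a n * r ^ n) \<le> (1/2) ^ n"
    using r nonneg by simp
  then show ?thesis by (rule summable_comparison_test_ev) (simp add: summable_geometric)
qed

lemma S_eq: "r > 0 \<Longrightarrow> S a r = 2 * (\<Sum>k\<in>active r. ln (a k * r ^ k))"
proof -
  assume r: "r > 0"
  have "(\<Sum>n. logp (a n * r ^ n)) = (\<Sum>k\<in>active r. logp (a k * r ^ k))"
  proof (rule suminf_finite[OF finite_active[OF r]])
    fix n assume "n \<notin> active r"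
    then have "a n * r ^ n \<le> 1" by (simp add: active_def)
    moreover have "a n * r ^ n \<ge> 0" using r nonneg by simp
    moreover have "ln x \<le> 0" if "0 \<le> x" "x \<le> 1" for x :: real
      using that by (cases "x = 0") auto
    ultimately have "ln (a n * r ^ n) \<le> 0" by blast
    then show "logp (a n * r ^ n) = 0" by (simp add: logp_def)
  qed
  also have "\<dots> = (\<Sum>k\<in>active r. ln (a k * r ^ k))"
    by (intro sum.cong) (auto simp: active_def logp_def max_def dest: ln_gt_zero)
  finally show ?thesis by (simp add: S_def)
qed

lemma active_pos: "k \<in> active r \<Longrightarrow> a k > 0"
  using nonneg[of k] by (cases "a k = 0") (auto simp: active_def)

lemma S_nonneg: "r > 0 \<Longrightarrow> S a r \<ge> 0"
  by (simp add: S_eq) (intro sum_nonneg, auto simp: active_def dest: ln_gt_zero less_imp_le)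

lemma exp_minus_S: "r > 0 \<Longrightarrow> exp (- S a r) = (\<Prod>k\<in>active r. inverse ((a k * r ^ k)\<^sup>2))"
proof -
  assume r: "r > 0"
  have "exp (- S a r) = exp (\<Sum>k\<in>active r. - 2 * ln (a k * r ^ k))"
    using r by (simp add: S_eq sum_distrib_left sum_negf)
  also have "\<dots> = (\<Prod>k\<in>active r. exp (- 2 * ln (a k * r ^ k)))"
    using r by (intro exp_sum finite_active)
  also have "\<dots> = (\<Prod>k\<in>active r. inverse ((a k * r ^ k)\<^sup>2))"
  proof (intro prod.cong refl)
    fix k assume "k \<in> active r"
    then have "a k * r ^ k > 0" by (simp add: active_def)
    then show "exp (- 2 * ln (a k * r ^ k)) = inverse ((a k * r ^ k)\<^sup>2)"
      by (simp add: exp_minus exp_double)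
  qed
  finally show ?thesis .
qed

end

lemma rapid_coeffs_of_decay:
  assumes nonneg: "\<And>n. a n \<ge> 0" and a0: "a 0 > 0"
    and decay: "(\<lambda>n. elog (a n) / ereal (real n)) \<longlonglongrightarrow> -\<infinity>"
  shows "rapid_coeffs a"
proof
  fix R :: real assume R: "R > 0"
  have "\<forall>\<^sub>F n in sequentially. elog (a n) / ereal (real n) < ereal (- ln R)"
    using decay by (simp add: tendsto_MInfty)
  then show "\<forall>\<^sub>F n in sequentially. a n * R ^ n \<le> 1"
    using eventually_gt_at_top[of 0]
  proof eventually_elim
    case (elim n)
    show ?case
    proof (cases "a n = 0")
      case False
      then have an: "a n > 0" using nonneg[of n] by simp
      then have "ln (a n) / real n < - ln R" using elim by (simp add: elog_def)
      then have "ln (a n) + real n * ln R < 0" using elim by (simp add: field_simps)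
      then have "ln (a n * R ^ n) < 0" using an R by (simp add: ln_mult ln_realpow)
      then show ?thesis using an R by (simp add: ln_less_zero_iff less_imp_le)
    qed simp
  qed
qed (use assms in auto)

section \<open>Growth of S and the exceptional radii\<close>

lemma one_minus_exp_ge: "x / 2 \<le> 1 - exp (- x)" if "0 \<le> x" "x \<le> 1" for x :: real
proof -
  have "(1 + x) * exp (- x) \<le> 1"
    using exp_ge_add_one_self[of x] by (simp add: exp_minus field_simps)
  moreover have "1 \<le> (1 + x) * (1 - x / 2)" using that mult_right_mono[of x 1 x] by (simp add: algebra_simps)
  ultimately have "(1 + x) * exp (- x) \<le> (1 + x) * (1 - x / 2)" by linarith
  then show ?thesis using that by (simp add: mult_le_cancel_left)
qed

lemma sum_nat_set_ge:
  fixes A :: "nat set"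
  assumes "finite A"
  shows "card A * (card A - 1) \<le> 2 * \<Sum>A"
  using assms
proof (induction A rule: finite_linorder_max_induct)
  case (insert b A)
  have "A \<subseteq> {..<b}" using insert.hyps by auto
  then have "card A \<le> b" using card_mono[of "{..<b}" A] by simp
  moreover have "b \<notin> A" using insert.hyps by auto
  moreover have "(card A + 1) * card A = 2 * card A + card A * (card A - 1)" by (cases "card A") auto
  ultimately show ?case using insert by simp
qed simp

context rapid_coeffs
begin

lemma active_mono: "0 < r \<Longrightarrow> r \<le> r' \<Longrightarrow> active r \<subseteq> active r'"
  using nonneg by (auto simp: active_def elim!: less_le_trans intro!: mult_left_mono power_mono)

text \<open>
  In the variable \<open>ln r\<close> every active term \<open>k\<close> contributes the slope \<open>2 * k\<close>, and the active indices are distinct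
  natural numbers.
\<close>

lemma S_growth:
  assumes r: "r > 0" and h: "h \<ge> 0"
  shows "S a (r * exp h) \<ge> S a r + h * real (card (active r) * (card (active r) - 1))"
proof -
  let ?A = "active r" and ?r = "r * exp h"
  have r': "?r > 0" and le: "r \<le> ?r" using r h by auto
  have fin: "finite ?A" using r by (rule finite_active)
  have shifted: "ln (a k * ?r ^ k) = ln (a k * r ^ k) + h * real k" if "k \<in> ?A" for k
  proof -
    have "a k * ?r ^ k = (a k * r ^ k) * exp (h * real k)"
      by (simp add: power_mult_distrib exp_of_nat2_mult)
    moreover have "a k * r ^ k > 0" using that by (simp add: active_def)
    ultimately show ?thesis by (simp only: ln_mult_pos exp_gt_zero ln_exp)
  qed
  have "S a r + h * real (card ?A * (card ?A - 1)) \<le> S a r + h * real (2 * \<Sum>?A)"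
    using sum_nat_set_ge[OF fin] h by (intro add_left_mono mult_left_mono) linarith+
  also have "\<dots> = 2 * (\<Sum>k\<in>?A. ln (a k * ?r ^ k))"
    by (simp add: S_eq[OF r] shifted sum.distrib sum_distrib_left mult_ac)
  also have "\<dots> \<le> 2 * (\<Sum>k\<in>active ?r. ln (a k * ?r ^ k))"
    using active_mono[OF r le] finite_active[OF r']
    by (intro mult_left_mono sum_mono2) (auto simp: active_def dest: ln_gt_zero less_imp_le)
  also have "\<dots> = S a ?r" by (simp add: S_eq[OF r'])
  finally show ?thesis .
qed

lemma S_mono:
  assumes "0 < r" "r \<le> r'"
  shows "S a r \<le> S a r'"
proof -
  have "S a r \<le> S a r + ln (r' / r) * real (card (active r) * (card (active r) - 1))"
    using assms by simp
  also have "\<dots> \<le> S a (r * exp (ln (r' / r)))" using assms by (intro S_growth) auto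
  finally show ?thesis using assms by simp
qed

lemma S_at_top:
  assumes k: "k \<ge> 1" "a k > 0"
  shows "filterlim (S a) at_top at_top"
proof (rule filterlim_at_top_mono)
  show "filterlim (\<lambda>r. 2 * (ln (a k) + real k * ln r)) at_top at_top"
    using k by real_asymp
  show "\<forall>\<^sub>F r in at_top. 2 * (ln (a k) + real k * ln r) \<le> S a r"
    using eventually_gt_at_top[of 0]
  proof eventually_elim
    case (elim r)
    have eq: "ln (a k) + real k * ln r = ln (a k * r ^ k)" using k elim by (simp add: ln_mult ln_realpow)
    show ?case
    proof (cases "k \<in> active r")
      case True
      have "ln (a k * r ^ k) \<le> (\<Sum>k\<in>active r. ln (a k * r ^ k))"
        using True finite_active[OF elim]
        by (intro member_le_sum) (auto simp: active_def dest: ln_gt_zero less_imp_le)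
      then show ?thesis by (simp add: S_eq[OF elim] eq)
    next
      case False
      then have "ln (a k * r ^ k) \<le> 0" using k elim by (simp add: active_def not_less)
      then show ?thesis using S_nonneg[OF elim] by (simp add: eq)
    qed
  qed
qed

text \<open>
  The end of the \<open>j\<close>-th dyadic level of \<open>S\<close>: by monotonicity, \<open>S a r < 2 ^ Suc j\<close> before it.
\<close>

definition level_end :: "nat \<Rightarrow> real" where
  "level_end j = Sup {r. r \<ge> 1 \<and> S a r < 2 ^ Suc j}"

text \<open>
  Any summable sequence that decays slowly in \<open>j\<close> works. Here \<open>j\<close> is about \<open>log 2 (S a r)\<close>, so the inverse
  of the step is a power of the logarithm of \<open>S a r\<close>.
\<close>

definition step :: "nat \<Rightarrow> real" where
  "step j = 1 / (real j + 1)\<^sup>2"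

text \<open>
  The radii that lie within the logarithmic distance \<open>step j\<close> before the end of a level.
\<close>

definition exceptional :: "real set" where
  "exceptional = (\<Union>j. {1..} \<inter> {level_end j * exp (- step j)..level_end j})"

lemma step_bounds: "0 < step j" "step j \<le> 1"
  by (auto simp: step_def)

lemma nn_integral_inverse_interval_le:
  assumes h: "0 < h" "h \<le> 1"
  shows "(\<integral>\<^sup>+t\<in>({1..} \<inter> {y * exp (- h)..y}). ennreal (1 / t) \<partial>lborel) \<le> ennreal (2 * h)"
proof (cases "y > 0")
  case False
  then have "{1..} \<inter> {y * exp (- h)..y} = {}" by auto
  then show ?thesis by simp
next
  case y: True
  let ?x = "y * exp (- h)"
  have "(\<integral>\<^sup>+t\<in>({1..} \<inter> {?x..y}). ennreal (1 / t) \<partial>lborel) \<le> (\<integral>\<^sup>+t. ennreal (1 / ?x) * indicator {?x..y} t \<partial>lborel)"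
    using y by (intro nn_integral_mono) (auto simp: indicator_def intro!: ennreal_leI divide_left_mono mult_pos_pos)
  also have "\<dots> = ennreal (1 / ?x) * ennreal (y - ?x)"
    using y h by (simp add: nn_integral_cmult_indicator)
  also have "\<dots> = ennreal (exp h - 1)"
    using y h by (subst ennreal_mult[symmetric]) (auto simp: field_simps exp_minus)
  also have "exp h - 1 \<le> 2 * h"
  proof -
    have "h * h \<le> h" using h by (simp add: mult_left_le)
    moreover have "exp h \<le> 1 + h + h\<^sup>2" using h by (intro exp_bound) auto
    ultimately show ?thesis unfolding power2_eq_square by linarith
  qed
  finally show ?thesis by (simp add: ennreal_leI)
qed

lemma exceptional_measure: "(\<integral>\<^sup>+t\<in>exceptional. ennreal (1 / t) \<partial>lborel) < \<infinity>"
proof -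
  let ?E = "\<lambda>j. {1..} \<inter> {level_end j * exp (- step j)..level_end j}"
  have "(\<integral>\<^sup>+t\<in>exceptional. ennreal (1 / t) \<partial>lborel) \<le> (\<integral>\<^sup>+t. (\<Sum>j. ennreal (1 / t) * indicator (?E j) t) \<partial>lborel)"
  proof (rule nn_integral_mono)
    fix t
    show "ennreal (1 / t) * indicator exceptional t \<le> (\<Sum>j. ennreal (1 / t) * indicator (?E j) t)"
    proof (cases "t \<in> exceptional")
      case True
      then obtain j where "t \<in> ?E j" unfolding exceptional_def by blast
      then have "ennreal (1 / t) * indicator exceptional t = (\<Sum>j\<in>{j}. ennreal (1 / t) * indicator (?E j) t)"
        using True by (simp del: sum_mult_indicator)
      also have "\<dots> \<le> (\<Sum>j. ennreal (1 / t) * indicator (?E j) t)"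
        by (intro sum_le_suminf) auto
      finally show ?thesis .
    qed simp
  qed
  also have "\<dots> = (\<Sum>j. \<integral>\<^sup>+t\<in>?E j. ennreal (1 / t) \<partial>lborel)"
    by (rule nn_integral_suminf) measurable
  also have "\<dots> \<le> (\<Sum>j. ennreal (2 * step j))"
    by (intro suminf_le summableI nn_integral_inverse_interval_le step_bounds)
  also have "\<dots> < \<infinity>"
  proof -
    have "summable step"
      using inverse_power_summable[of 2, where 'a=real]
        summable_Suc_iff[of "\<lambda>j. inverse ((of_nat j)\<^sup>2) :: real"]
      by (simp add: step_def[abs_def] inverse_eq_divide add.commute)
    then have "summable (\<lambda>j. 2 * step j)" by (rule summable_mult)
    then have "(\<Sum>j. ennreal (2 * step j)) \<noteq> top"
      using step_bounds(1) by (intro ennreal_suminf_neq_top) (auto simp: less_imp_le)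
    then show ?thesis by (simp add: less_top)
  qed
  finally show ?thesis .
qed

lemma exceptional_borel: "exceptional \<in> sets borel"
  unfolding exceptional_def by measurable

text \<open>
  A radius in the \<open>j\<close>-th level that is not within \<open>step j\<close> of the end of the level stays in the level when
  multiplied by \<open>exp (step j)\<close>.
\<close>

lemma doubling_off_exceptional:
  assumes k: "k \<ge> 1" "a k > 0" and r: "r \<ge> 1" "r \<notin> exceptional" "S a r \<ge> 1"
  obtains h where "0 < h" "h \<le> 1" "1 / h \<le> (2 * ln (S a r) + 1)\<^sup>2" "S a (r * exp h) \<le> 2 * S a r"
proof
  define x where "x = S a r"
  define j where "j = nat \<lfloor>log 2 x\<rfloor>"
  let ?h = "step j"
  have x: "x \<ge> 1" using r by (simp add: x_def)
  then have lx: "log 2 x \<ge> 0" by simp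
  then have j: "real j \<le> log 2 x" "log 2 x < real j + 1" unfolding j_def by linarith+
  have "2 powr real j \<le> x" using j(1) x by (simp add: le_log_iff)
  then have xj: "2 ^ j \<le> x" by (simp add: powr_realpow)
  have "x < 2 powr real (Suc j)" using j(2) x by (simp add: log_less_iff add.commute)
  then have xj': "x < 2 ^ Suc j" by (simp only: powr_realpow[of 2 "Suc j"])
  let ?L = "{r. r \<ge> 1 \<and> S a r < 2 ^ Suc j}"
  have "bdd_above ?L"
  proof -
    from S_at_top[OF k] have "\<forall>\<^sub>F r in at_top. S a r \<ge> 2 ^ Suc j" by (simp add: filterlim_at_top)
    then obtain N where N: "\<And>r. r \<ge> N \<Longrightarrow> S a r \<ge> 2 ^ Suc j" by (auto simp: eventually_at_top_linorder)
    show ?thesis 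
    proof (rule bdd_aboveI[of _ N])
      fix r assume "r \<in> ?L"
      then have "\<not> S a r \<ge> 2 ^ Suc j" by simp
      then show "r \<le> N" using N[of r] by linarith
    qed
  qed
  moreover have rL: "r \<in> ?L" using r xj' by (simp add: x_def)
  ultimately have "r \<le> level_end j" unfolding level_end_def by (rule cSup_upper[rotated])
  then have "r < level_end j * exp (- ?h)"
    using r unfolding exceptional_def by (auto simp: not_le[symmetric])
  then have "r * exp ?h < level_end j" by (simp add: exp_minus field_simps)
  then obtain r' where r': "r' \<in> ?L" "r * exp ?h < r'"
    unfolding level_end_def by (rule less_cSupE) (use rL in auto)
  show "0 < ?h" "?h \<le> 1" by (rule step_bounds)+
  have "S a (r * exp ?h) \<le> S a r'" using r r' by (intro S_mono) auto
  also have "\<dots> < 2 ^ Suc j" using r' by simp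
  finally show "S a (r * exp ?h) \<le> 2 * S a r" using xj by (simp add: x_def)
  have "log 2 x \<le> 2 * ln x"
  proof -
    have "1 / ln 2 \<le> (2::real)" using ln2_ge_two_thirds by (simp add: field_simps)
    then show ?thesis using x mult_right_mono[of "1 / ln 2" 2 "ln x"] by (simp add: log_def)
  qed
  then have "(real j + 1)\<^sup>2 \<le> (2 * ln x + 1)\<^sup>2" using j by (intro power_mono) auto
  then show "1 / ?h \<le> (2 * ln (S a r) + 1)\<^sup>2" by (simp add: step_def x_def)
qed

text \<open>
  Half of the available distance \<open>h\<close> is spent on making the terms outside \<open>active (r * exp g)\<close> decay
  geometrically at \<open>r\<close>, the other half on bounding the number of active terms at \<open>r * exp g\<close> by the growth of \<open>S\<close>
  beyond it.
\<close>

lemma regular_radius: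
  assumes k: "k \<ge> 1" "a k > 0" and r: "r \<ge> 1" "r \<notin> exceptional" "S a r \<ge> 1"
  obtains g where "0 < g" "g \<le> 1" "1 / g \<le> 2 * (2 * ln (S a r) + 1)\<^sup>2"
    "real (card (active (r * exp g))) \<le> 1 + 2 * sqrt (S a r) * (2 * ln (S a r) + 1)"
proof -
  obtain h where h: "0 < h" "h \<le> 1" "1 / h \<le> (2 * ln (S a r) + 1)\<^sup>2" "S a (r * exp h) \<le> 2 * S a r"
    using doubling_off_exceptional[OF k r] by blast
  define g where "g = h / 2"
  define n where "n = card (active (r * exp g))"
  let ?l = "2 * ln (S a r) + 1"
  have l: "?l \<ge> 1" using r by simp
  have "g * real (n * (n - 1)) \<le> S a (r * exp g) + g * real (n * (n - 1))"
    using r by (simp add: S_nonneg)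
  also have "\<dots> \<le> S a (r * exp g * exp g)"
    unfolding n_def using h r by (intro S_growth) (auto simp: g_def)
  also have "r * exp g * exp g = r * exp h" by (simp add: g_def exp_add[symmetric])
  also have "S a (r * exp h) \<le> 2 * S a r" by (rule h)
  finally have *: "g * real (n * (n - 1)) \<le> 2 * S a r" .
  have "real n \<le> 1 + 2 * sqrt (S a r) * ?l"
  proof (cases "n = 0")
    case True
    then show ?thesis using r l by simp
  next
    case False
    have "(real n - 1)\<^sup>2 \<le> real (n * (n - 1))"
      using False by (simp add: power2_eq_square of_nat_diff mult_right_mono)
    also have "\<dots> \<le> 2 * S a r / g" using * h by (simp add: g_def field_simps)
    also have "\<dots> = 4 * S a r * (1 / h)" by (simp add: g_def)
    also have "\<dots> \<le> 4 * S a r * ?l\<^sup>2" using h r by (intro mult_left_mono) auto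
    also have "\<dots> = (2 * sqrt (S a r) * ?l)\<^sup>2" using r by (simp add: power_mult_distrib)
    finally have "real n - 1 \<le> 2 * sqrt (S a r) * ?l"
      by (rule power2_le_imp_le) (use r l in auto)
    then show ?thesis by simp
  qed
  then show ?thesis using h by (intro that[of g]) (auto simp: g_def n_def)
qed

lemma suminf_coeffs_le:
  assumes r: "r > 0" and g: "0 < g" "g \<le> 1"
  shows "(\<Sum>n. a n * r ^ n) \<le> real (card (active (r * exp g))) * exp (S a r) + 2 / g"
proof -
  let ?J = "active (r * exp g)"
  have J: "finite ?J" using r by (intro finite_active) auto
  have on: "a k * r ^ k \<le> exp (S a r)" for k
  proof (cases "k \<in> active r")
    case True
    have "ln (a k * r ^ k) \<le> (\<Sum>k\<in>active r. ln (a k * r ^ k))"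
      using True finite_active[OF r]
      by (intro member_le_sum) (auto simp: active_def dest: ln_gt_zero less_imp_le)
    also have "\<dots> \<le> S a r" using S_nonneg[OF r] by (simp add: S_eq[OF r])
    finally have "exp (ln (a k * r ^ k)) \<le> exp (S a r)" by simp
    moreover have "a k * r ^ k > 0" using True by (simp add: active_def)
    ultimately show ?thesis by (simp only: exp_ln)
  next
    case False
    then have "a k * r ^ k \<le> 1" by (simp add: active_def)
    also have "1 \<le> exp (S a r)" using S_nonneg[OF r] by simp
    finally show ?thesis .
  qed
  have off: "a k * r ^ k \<le> exp (- g) ^ k" if "k \<notin> ?J" for k
  proof -
    have "a k * r ^ k = a k * (r * exp g) ^ k * exp (- g) ^ k"
      by (simp add: power_mult_distrib exp_minus power_inverse)
    also have "\<dots> \<le> 1 * exp (- g) ^ k" using that by (intro mult_right_mono) (auto simp: active_def)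
    finally show ?thesis by simp
  qed
  have "(\<lambda>k. if k \<in> ?J then exp (S a r) else 0) sums (\<Sum>k\<in>?J. exp (S a r))"
    by (rule sums_If_finite_set[OF J])
  moreover have "(\<lambda>k. exp (- g) ^ k) sums (1 / (1 - exp (- g)))"
    using g by (intro geometric_sums) auto
  ultimately have "(\<lambda>k. (if k \<in> ?J then exp (S a r) else 0) + exp (- g) ^ k) sums
     ((\<Sum>k\<in>?J. exp (S a r)) + 1 / (1 - exp (- g)))" by (rule sums_add)
  then have s: "(\<lambda>k. (if k \<in> ?J then exp (S a r) else 0) + exp (- g) ^ k) sums
     (real (card ?J) * exp (S a r) + 1 / (1 - exp (- g)))" by simp
  have "(\<Sum>n. a n * r ^ n) \<le> real (card ?J) * exp (S a r) + 1 / (1 - exp (- g))"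
  proof (rule sums_le[OF _ summable_sums[OF summable_coeffs] s])
    show "a k * r ^ k \<le> (if k \<in> ?J then exp (S a r) else 0) + exp (- g) ^ k" for k
      using on[of k] off[of k] by (cases "k \<in> ?J") (simp_all add: add_increasing2)
  qed (use r in auto)
  also have "1 / (1 - exp (- g)) \<le> 2 / g"
  proof -
    have "g / 2 \<le> 1 - exp (- g)" using one_minus_exp_ge[of g] g by simp
    then show ?thesis using g by (simp add: field_simps)
  qed
  finally show ?thesis by simp
qed

end

section \<open>The random entire function\<close>

locale gaussian_entire = iid_gaussians M \<xi> + rapid_coeffs a
  for M :: "'w measure" and \<xi> :: "nat \<Rightarrow> 'w \<Rightarrow> complex" and a :: "nat \<Rightarrow> real"
begin

abbreviation f :: "'w \<Rightarrow> complex \<Rightarrow> complex" where "f \<equiv> gef a \<xi>"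

definition majorant :: "real \<Rightarrow> 'w \<Rightarrow> ennreal" where
  "majorant x \<omega> = (\<Sum>n. ennreal (cmod (\<xi> n \<omega>) * (a n * x ^ n)))"

definition entire_outcomes :: "'w set" where
  "entire_outcomes = {\<omega>\<in>space M. \<forall>z. summable (\<lambda>n. \<xi> n \<omega> * of_real (a n) * z ^ n)}"

lemma majorant_measurable[measurable]: "majorant x \<in> borel_measurable M"
  unfolding majorant_def by measurable

lemma nn_integral_majorant_le:
  assumes "x \<ge> 0"
  shows "(\<integral>\<^sup>+\<omega>. majorant x \<omega> \<partial>M) \<le> ennreal (2 * (\<Sum>n. a n * x ^ n))"
proof -
  have "(\<integral>\<^sup>+\<omega>. majorant x \<omega> \<partial>M) = (\<Sum>n. \<integral>\<^sup>+\<omega>. ennreal (cmod (\<xi> n \<omega>) * (a n * x ^ n)) \<partial>M)"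
    unfolding majorant_def by (rule nn_integral_suminf) measurable
  also have "\<dots> = (\<Sum>n. ennreal (a n * x ^ n) * (\<integral>\<^sup>+\<omega>. ennreal (cmod (\<xi> n \<omega>)) \<partial>M))"
    using assms nonneg by (subst nn_integral_cmult[symmetric]) (auto simp: ennreal_mult mult.commute)
  also have "\<dots> \<le> (\<Sum>n. ennreal (2 * (a n * x ^ n)))"
  proof (intro suminf_le summableI)
    fix n
    have "ennreal (a n * x ^ n) * (\<integral>\<^sup>+\<omega>. ennreal (cmod (\<xi> n \<omega>)) \<partial>M) \<le> ennreal (a n * x ^ n) * 2"
      by (intro mult_left_mono mean_cmod_le) auto
    then show "ennreal (a n * x ^ n) * (\<integral>\<^sup>+\<omega>. ennreal (cmod (\<xi> n \<omega>)) \<partial>M) \<le> ennreal (2 * (a n * x ^ n))"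
      using assms nonneg by (simp add: ennreal_mult mult.commute)
  qed
  also have "\<dots> = ennreal (2 * (\<Sum>n. a n * x ^ n))"
    using assms nonneg summable_coeffs[OF assms]
    by (subst suminf_ennreal2) (auto simp: suminf_mult)
  finally show ?thesis .
qed

text \<open>
  Countably many absolute series decide the convergence at all points, which makes the event
  measurable.
\<close>

lemma entire_outcomes_eq: "entire_outcomes = {\<omega>\<in>space M. \<forall>k::nat. majorant (real k) \<omega> \<noteq> \<infinity>}"
proof -
  have "(\<forall>z. summable (\<lambda>n. \<xi> n \<omega> * of_real (a n) * z ^ n)) \<longleftrightarrow> (\<forall>k::nat. majorant (real k) \<omega> \<noteq> \<infinity>)" for \<omega>
  proof safe
    fix k :: nat
    assume s: "\<forall>z. summable (\<lambda>n. \<xi> n \<omega> * of_real (a n) * z ^ n)" and "majorant (real k) \<omega> = \<infinity>"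
    have "summable (\<lambda>n. norm (\<xi> n \<omega> * of_real (a n) * (of_nat k) ^ n))"
      by (rule powser_insidea[where x="of_nat (Suc k)"]) (use s in \<open>auto simp del: of_nat_Suc\<close>)
    then have "summable (\<lambda>n. cmod (\<xi> n \<omega>) * (a n * real k ^ n))"
      using nonneg by (simp add: norm_mult norm_power mult.assoc)
    then have "majorant (real k) \<omega> \<noteq> \<infinity>"
      unfolding majorant_def infinity_ennreal_def using nonneg by (intro ennreal_suminf_neq_top) auto
    then show False using \<open>majorant (real k) \<omega> = \<infinity>\<close> by simp
  next
    fix z
    assume fin: "\<forall>k::nat. majorant (real k) \<omega> \<noteq> \<infinity>"
    obtain k :: nat where k: "cmod z \<le> real k" using real_arch_simple by blast
    have "summable (\<lambda>n. cmod (\<xi> n \<omega>) * (a n * real k ^ n))"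
      using fin nonneg unfolding majorant_def infinity_ennreal_def by (intro summable_suminf_not_top) auto
    then have "summable (\<lambda>n. norm (\<xi> n \<omega> * of_real (a n) * z ^ n))"
    proof (rule summable_comparison_test_ev[rotated], intro always_eventually allI)
      fix n
      have "cmod z ^ n \<le> real k ^ n" using k by (intro power_mono) auto
      then show "norm (norm (\<xi> n \<omega> * of_real (a n) * z ^ n)) \<le> cmod (\<xi> n \<omega>) * (a n * real k ^ n)"
        using nonneg by (simp add: norm_mult norm_power mult.assoc mult_left_mono)
    qed
    then show "summable (\<lambda>n. \<xi> n \<omega> * of_real (a n) * z ^ n)" by (rule summable_norm_cancel)
  qed
  then show ?thesis unfolding entire_outcomes_def by simp
qed

lemma entire_outcomes_sets[measurable]: "entire_outcomes \<in> sets M"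
  unfolding entire_outcomes_eq by measurable

text \<open>
  The majorants have finite expectation because the absolute moments of the \<open>\<xi> n\<close> are bounded.
\<close>

lemma AE_entire: "AE \<omega> in M. \<omega> \<in> entire_outcomes"
proof -
  have "AE \<omega> in M. majorant (real k) \<omega> \<noteq> \<infinity>" for k :: nat
  proof (rule nn_integral_PInf_AE)
    show "(\<integral>\<^sup>+\<omega>. majorant (real k) \<omega> \<partial>M) \<noteq> \<infinity>"
      using nn_integral_majorant_le[of "real k"] by (auto simp: top_unique)
  qed measurable
  then have "AE \<omega> in M. \<forall>k::nat. majorant (real k) \<omega> \<noteq> \<infinity>" by (simp add: AE_all_countable)
  then show ?thesis by (auto simp: entire_outcomes_eq elim!: AE_mp)
qed

lemma f_measurable[measurable]: "(\<lambda>\<omega>. f \<omega> z) \<in> borel_measurable M"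
  unfolding gef_def by measurable

lemma f_sums: "\<omega> \<in> entire_outcomes \<Longrightarrow> (\<lambda>n. \<xi> n \<omega> * of_real (a n) * z ^ n) sums f \<omega> z"
  unfolding gef_def entire_outcomes_def by (auto intro: summable_sums)

lemma f_holomorphic: "\<omega> \<in> entire_outcomes \<Longrightarrow> f \<omega> holomorphic_on UNIV"
proof -
  assume \<omega>: "\<omega> \<in> entire_outcomes"
  have "f \<omega> holomorphic_on ball 0 x" for x
    by (rule power_series_holomorphic[where a="\<lambda>n. \<xi> n \<omega> * of_real (a n)"]) (use f_sums[OF \<omega>] in simp)
  then have "f \<omega> holomorphic_on (\<Union>x. ball 0 x)"
    by (intro holomorphic_on_UN_open) auto
  moreover have "(\<Union>x. ball (0::complex) x) = UNIV"
    by (auto intro: gt_ex)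
  ultimately show ?thesis by metis
qed

lemma f_0: "f \<omega> 0 = \<xi> 0 \<omega> * of_real (a 0)"
  unfolding gef_def by (subst suminf_finite[of "{0}"]) auto

lemma norm_f_le_majorant:
  assumes "\<omega> \<in> entire_outcomes" "cmod z \<le> x" "x \<ge> 0"
  shows "ennreal (cmod (f \<omega> z)) \<le> majorant x \<omega>"
proof -
  obtain k :: nat where k: "x \<le> real k" using real_arch_simple by blast
  have "summable (\<lambda>n. cmod (\<xi> n \<omega>) * (a n * real k ^ n))"
    using assms(1) nonneg unfolding entire_outcomes_eq majorant_def infinity_ennreal_def by (intro summable_suminf_not_top) auto
  then have sx: "summable (\<lambda>n. cmod (\<xi> n \<omega>) * (a n * x ^ n))"
    by (rule summable_comparison_test_ev[rotated])
      (use k assms nonneg in \<open>auto intro!: always_eventually mult_left_mono power_mono\<close>)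
  have le: "norm (\<xi> n \<omega> * of_real (a n) * z ^ n) \<le> cmod (\<xi> n \<omega>) * (a n * x ^ n)" for n
    using assms nonneg by (auto simp: norm_mult norm_power mult.assoc intro!: mult_left_mono power_mono)
  have "cmod (f \<omega> z) \<le> (\<Sum>n. cmod (\<xi> n \<omega>) * (a n * x ^ n))"
    unfolding gef_def using summable_comparison_test'[OF sx, of 0 "\<lambda>n. norm (\<xi> n \<omega> * of_real (a n) * z ^ n)"] le
    by (intro order_trans[OF summable_norm] suminf_le sx) auto
  then show ?thesis
    unfolding majorant_def using sx nonneg assms by (subst suminf_ennreal2) (auto intro: ennreal_leI)
qed

lemma hole_event_eq: "hole_event M a \<xi> r = {\<omega>\<in>entire_outcomes. \<forall>z. cmod z < r \<longrightarrow> f \<omega> z \<noteq> 0}"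
  by (auto simp: hole_event_def entire_outcomes_def)

text \<open>
  On every smaller disc a continuous function without zeros is bounded away from \<open>0\<close>, and for a
  continuous function this can be tested on a countable dense set.
\<close>

lemma hole_event_sets[measurable]: "hole_event M a \<xi> r \<in> sets M"
proof -
  obtain D :: "complex set" where D: "countable D" "\<And>X. open X \<Longrightarrow> X \<noteq> {} \<Longrightarrow> \<exists>d\<in>D. d \<in> X"
    using countable_dense_setE by blast
  \<comment> \<open>an enumeration, so that the quantifier over \<open>D\<close> ranges over a countable type\<close>
  define e where "e = from_nat_into D"
  have "D \<noteq> {}" using D(2)[of UNIV] by auto
  then have e: "range e = D" unfolding e_def using D(1) by (rule range_from_nat_into)
  define s where "s m = r - 1 / (real m + 1)" for m :: nat
  have "(\<forall>z. cmod z < r \<longrightarrow> f \<omega> z \<noteq> 0) \<longleftrightarrow>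
     (\<forall>m. \<exists>k::nat. \<forall>i. cmod (e i) < s m \<longrightarrow> cmod (f \<omega> (e i)) \<ge> 1 / (real k + 1))" (is "?L \<longleftrightarrow> ?R")
    if \<omega>: "\<omega> \<in> entire_outcomes" for \<omega>
  proof -
    have cont: "continuous_on UNIV (\<lambda>z. cmod (f \<omega> z))"
      by (intro continuous_intros holomorphic_on_imp_continuous_on f_holomorphic \<omega>)
    show ?thesis
    proof safe
      fix m assume L: ?L
      show "\<exists>k::nat. \<forall>i. cmod (e i) < s m \<longrightarrow> cmod (f \<omega> (e i)) \<ge> 1 / (real k + 1)"
      proof (cases "cball (0::complex) (s m) = {}")
        case True
        then have "s m < 0" by simp
        then have "\<not> cmod d < s m" for d using norm_ge_zero[of d] by linarith
        then show ?thesis by blast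
      next
        case False
        then have "\<exists>z\<in>cball 0 (s m). \<forall>w\<in>cball 0 (s m). cmod (f \<omega> z) \<le> cmod (f \<omega> w)"
          by (intro continuous_attains_inf continuous_on_subset[OF cont]) auto
        then obtain z where z: "z \<in> cball 0 (s m)" "\<And>w. w \<in> cball 0 (s m) \<Longrightarrow> cmod (f \<omega> z) \<le> cmod (f \<omega> w)"
          by auto
        have "s m < r" by (simp add: s_def)
        then have "cmod (f \<omega> z) > 0" using L z(1) by auto
        then obtain k :: nat where "1 / (real k + 1) < cmod (f \<omega> z)"
          using reals_Archimedean[of "cmod (f \<omega> z)"] by (auto simp: inverse_eq_divide add.commute)
        moreover have "cmod (f \<omega> z) \<le> cmod (f \<omega> (e i))" if "cmod (e i) < s m" for i
          using that by (intro z(2)) auto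
        ultimately have "\<forall>i. cmod (e i) < s m \<longrightarrow> cmod (f \<omega> (e i)) \<ge> 1 / (real k + 1)"
          by (meson less_imp_le order.trans)
        then show ?thesis by blast
      qed
    next
      fix z assume R: ?R and z: "cmod z < r" "f \<omega> z = 0"
      obtain m :: nat where "1 / (real m + 1) < r - cmod z"
        using reals_Archimedean[of "r - cmod z"] z by (auto simp: inverse_eq_divide add.commute)
      then have m: "cmod z < s m" by (simp add: s_def)
      from R obtain k :: nat where k: "\<And>i. cmod (e i) < s m \<Longrightarrow> cmod (f \<omega> (e i)) \<ge> 1 / (real k + 1)" by blast
      define X where "X = {w. cmod w < s m} \<inter> {w. cmod (f \<omega> w) < 1 / (real k + 1)}"
      have "open X" unfolding X_def
        by (intro open_Int open_Collect_less cont) (intro continuous_intros)+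
      moreover have "z \<in> X" using z m by (simp add: X_def)
      ultimately obtain i where "e i \<in> X" using D(2) e by (metis empty_iff imageE)
      then show False using k[of i] by (auto simp: X_def)
    qed
  qed
  then have "hole_event M a \<xi> r = {\<omega>\<in>space M. \<omega> \<in> entire_outcomes \<and>
       (\<forall>m. \<exists>k::nat. \<forall>i. cmod (e i) < s m \<longrightarrow> cmod (f \<omega> (e i)) \<ge> 1 / (real k + 1))}"
    unfolding hole_event_eq by (auto simp: entire_outcomes_def)
  also have "\<dots> \<in> sets M"
    by measurable
  finally show ?thesis .
qed

end

section \<open>Upper bound for the hole probability\<close>

context gaussian_entire
begin

lemma f_split:
  assumes "\<omega> \<in> entire_outcomes" "finite I"
  shows "f \<omega> z = (\<Sum>n. if n \<in> I then 0 else \<xi> n \<omega> * of_real (a n) * z ^ n) + (\<Sum>n\<in>I. \<xi> n \<omega> * of_real (a n) * z ^ n)"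
proof -
  let ?t = "\<lambda>n. \<xi> n \<omega> * of_real (a n) * z ^ n"
  have "(\<lambda>n. if n \<in> I then ?t n else 0) sums (\<Sum>n\<in>I. ?t n)"
    by (rule sums_If_finite_set[OF assms(2)])
  from sums_diff[OF f_sums[OF assms(1)] this]
  have "(\<lambda>n. if n \<in> I then 0 else ?t n) sums (f \<omega> z - (\<Sum>n\<in>I. ?t n))"
    by (rule sums_cong[THEN iffD1, rotated]) auto
  then show ?thesis by (simp add: sums_iff)
qed

text \<open>
  The rotation and the radius in \<open>\<zeta>\<close> go into the factors \<open>b k\<close>, and the terms outside \<open>I\<close> into the shifts \<open>w j\<close>.
\<close>

lemma nn_integral_prod_le:
  assumes I: "finite I" and u: "contracting I u" and G[measurable]: "G \<in> borel_measurable borel" and rad: "radial G"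
    and \<zeta>: "\<zeta> \<noteq> 0" and pos: "\<And>k. k \<in> I \<Longrightarrow> a k > 0"
  shows "(\<integral>\<^sup>+\<omega>. (\<Prod>j\<in>I. G (f \<omega> (\<zeta> * u j))) \<partial>M) \<le>
     ennreal (\<Prod>k\<in>I. inverse ((a k * cmod \<zeta> ^ k)\<^sup>2)) * (ennreal (1 / pi) * (\<integral>\<^sup>+z. G z \<partial>lborel)) ^ card I"
proof -
  define w where "w j y = (\<Sum>n. if n \<in> I then 0 else y n * of_real (a n) * (\<zeta> * u j) ^ n)" for j and y :: "nat \<Rightarrow> complex"
  define b where "b k = of_real (a k) * \<zeta> ^ k" for k
  define \<Psi> where "\<Psi> x y = (\<Prod>j\<in>I. G (w j y + (\<Sum>k\<in>I. b k * x k * u j ^ k)))" for x y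
  have [measurable]: "(\<lambda>y. w j y) \<in> borel_measurable (PiM (- I) (\<lambda>_. borel))" for j
    unfolding w_def
  proof (rule borel_measurable_suminf)
    fix n show "(\<lambda>y. if n \<in> I then 0 else y n * complex_of_real (a n) * (\<zeta> * u j) ^ n) \<in> borel_measurable (Pi\<^sub>M (- I) (\<lambda>_. borel))"
      by (cases "n \<in> I") auto
  qed
  have "(\<integral>\<^sup>+\<omega>. (\<Prod>j\<in>I. G (f \<omega> (\<zeta> * u j))) \<partial>M) = (\<integral>\<^sup>+\<omega>. \<Psi> (\<lambda>i\<in>I. \<xi> i \<omega>) (\<lambda>i\<in>-I. \<xi> i \<omega>) \<partial>M)"
  proof (rule nn_integral_cong_AE)
    show "AE \<omega> in M. (\<Prod>j\<in>I. G (f \<omega> (\<zeta> * u j))) = \<Psi> (\<lambda>i\<in>I. \<xi> i \<omega>) (\<lambda>i\<in>-I. \<xi> i \<omega>)"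
      using AE_entire
    proof eventually_elim
      case (elim \<omega>)
      have "w j (\<lambda>i\<in>-I. \<xi> i \<omega>) + (\<Sum>k\<in>I. b k * (\<lambda>i\<in>I. \<xi> i \<omega>) k * u j ^ k) = f \<omega> (\<zeta> * u j)" for j
        unfolding f_split[OF elim I] w_def b_def
        by (intro arg_cong2[of _ _ _ _ "(+)"] suminf_cong sum.cong) (auto simp: power_mult_distrib mult_ac)
      then show ?case by (simp add: \<Psi>_def)
    qed
  qed
  also have "\<dots> \<le> ennreal (1 / pi) ^ card I * (ennreal (\<Prod>k\<in>I. inverse (cmod (b k) ^ 2)) * (\<integral>\<^sup>+z. G z \<partial>lborel) ^ card I)"
  proof (rule nn_integral_split_le[OF I])
    show "(\<lambda>(x, y). \<Psi> x y) \<in> borel_measurable (Pi\<^sub>M I (\<lambda>_. borel) \<Otimes>\<^sub>M Pi\<^sub>M (- I) (\<lambda>_. borel))"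
      unfolding \<Psi>_def by measurable
    show "(\<integral>\<^sup>+x. \<Psi> x y \<partial>PiM I (\<lambda>_. lborel)) \<le> ennreal (\<Prod>k\<in>I. inverse (cmod (b k) ^ 2)) * (\<integral>\<^sup>+z. G z \<partial>lborel) ^ card I" for y
      unfolding \<Psi>_def using pos \<zeta> by (intro contractingD[OF u G rad]) (force simp: b_def)
  qed
  also have "(\<Prod>k\<in>I. inverse (cmod (b k) ^ 2)) = (\<Prod>k\<in>I. inverse ((a k * cmod \<zeta> ^ k)\<^sup>2))"
    using nonneg by (simp add: b_def norm_mult norm_power)
  finally show ?thesis by (simp add: power_mult_distrib mult_ac)
qed

text \<open>
  On the event the mean value inequality applies, where \<open>\<bar>f 0\<bar> powr (d - 2)\<close> is at least \<open>B powr (d - 2)\<close> and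
  every factor on the circle equal to the truncated power. Taking expectations and exchanging
  the integrals leaves, for each rotation, the expectation in \<open>nn_integral_prod_le\<close>.
\<close>

lemma truncated_hole_le:
  assumes \<rho>: "0 < \<rho>" "\<rho> < r" and d: "0 < d" "d \<le> 1" and R: "R > 0" and B: "B > 0"
    and I: "finite I" and pos: "\<And>k. k \<in> I \<Longrightarrow> a k > 0"
  shows "prob {\<omega>\<in>hole_event M a \<xi> r. cmod (f \<omega> 0) \<le> B \<and> majorant r \<omega> \<le> ennreal R} \<le>
     (B powr (2 - d) * (12 * R powr d / d)) ^ card I * (\<Prod>k\<in>I. inverse ((a k * \<rho> ^ k)\<^sup>2))"
proof -
  obtain u where u: "\<And>j. j \<in> I \<Longrightarrow> cmod (u j) = 1" and contr: "contracting I u"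
    using interpolation_points[OF I] by blast
  let ?A = "{\<omega>\<in>hole_event M a \<xi> r. cmod (f \<omega> 0) \<le> B \<and> majorant r \<omega> \<le> ennreal R}"
  let ?z = "\<lambda>t. of_real \<rho> * cis (2 * pi * t)"
  let ?c = "ennreal (B powr (2 - d)) ^ card I"
  let ?F = "\<lambda>\<omega>. (\<integral>\<^sup>+t\<in>{0..1}. (\<Prod>j\<in>I. trunc_power d R (f \<omega> (?z t * u j))) \<partial>lborel)"
  let ?K = "ennreal ((12 * R powr d / d) ^ card I * (\<Prod>k\<in>I. inverse ((a k * \<rho> ^ k)\<^sup>2)))"
  have [measurable]: "?A = {\<omega>\<in>space M. \<omega> \<in> hole_event M a \<xi> r \<and> cmod (f \<omega> 0) \<le> B \<and> majorant r \<omega> \<le> ennreal R}"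
    by (auto simp: hole_event_def)
  have [measurable]: "?A \<in> sets M" unfolding \<open>?A = _\<close> by measurable
  have key: "indicator ?A \<omega> \<le> ?c * ?F \<omega>" for \<omega>
  proof (cases "\<omega> \<in> ?A")
    case True
    then have \<omega>: "\<omega> \<in> entire_outcomes" and nz: "\<And>z. cmod z < r \<Longrightarrow> f \<omega> z \<noteq> 0"
      and f0: "cmod (f \<omega> 0) \<le> B" and maj: "majorant r \<omega> \<le> ennreal R" by (auto simp: hole_event_eq)
    have "f \<omega> 0 \<noteq> 0" using nz[of 0] \<rho> by simp
    have "ennreal (cmod (f \<omega> 0) powr (- (2 - d))) ^ card I \<le>
      (\<integral>\<^sup>+t\<in>{0..1}. (\<Prod>j\<in>I. ennreal (cmod (f \<omega> (?z t * u j)) powr (- (2 - d)))) \<partial>lborel)"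
      by (rule zero_free_mean_inequality[OF holomorphic_on_subset[OF f_holomorphic[OF \<omega>]] nz \<rho> I u]) auto
    also have "\<dots> = ?F \<omega>"
    proof (intro nn_integral_cong arg_cong2[of _ _ _ _ "(*)"] prod.cong refl)
      fix t :: real and j assume "j \<in> I"
      then have c: "cmod (?z t * u j) < r" using u \<rho> by (simp add: norm_mult)
      have "ennreal (cmod (f \<omega> (?z t * u j))) \<le> ennreal R"
        using norm_f_le_majorant[OF \<omega> less_imp_le[OF c]] \<rho> maj by (auto intro: order_trans)
      then have "cmod (f \<omega> (?z t * u j)) \<le> R" using R by (subst (asm) ennreal_le_iff) auto
      then show "ennreal (cmod (f \<omega> (?z t * u j)) powr (- (2 - d))) = trunc_power d R (f \<omega> (?z t * u j))"
        using nz[OF c] by (simp add: trunc_power_def)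
    qed
    finally have le: "ennreal (cmod (f \<omega> 0) powr (- (2 - d))) ^ card I \<le> ?F \<omega>" .
    have "1 \<le> B powr (2 - d) * cmod (f \<omega> 0) powr (- (2 - d))"
    proof -
      have "1 = B powr (2 - d) * B powr (- (2 - d))" using B by (subst powr_add[symmetric]) simp
      also have "\<dots> \<le> B powr (2 - d) * cmod (f \<omega> 0) powr (- (2 - d))"
        using \<open>f \<omega> 0 \<noteq> 0\<close> f0 B d by (intro mult_left_mono powr_mono2') auto
      finally show ?thesis .
    qed
    then have "1 \<le> ennreal (B powr (2 - d)) * ennreal (cmod (f \<omega> 0) powr (- (2 - d)))"
      by (subst ennreal_mult[symmetric]) (auto simp flip: ennreal_1 intro: ennreal_leI)
    then have "1 \<le> (ennreal (B powr (2 - d)) * ennreal (cmod (f \<omega> 0) powr (- (2 - d)))) ^ card I"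
      by (rule one_le_power)
    also have "\<dots> \<le> ?c * ?F \<omega>"
      unfolding power_mult_distrib by (intro mult_left_mono le) auto
    finally show ?thesis using True by simp
  qed auto
  have jm[measurable]: "(\<lambda>(\<omega>, t). f \<omega> (?z t * u j)) \<in> borel_measurable (M \<Otimes>\<^sub>M lborel)" for j
    unfolding gef_def cis_conv_exp by measurable
  interpret P: pair_sigma_finite M "lborel :: real measure" ..
  have "emeasure M ?A = (\<integral>\<^sup>+\<omega>. indicator ?A \<omega> \<partial>M)" by simp
  also have "\<dots> \<le> (\<integral>\<^sup>+\<omega>. ?c * ?F \<omega> \<partial>M)" by (intro nn_integral_mono key)
  also have "\<dots> = ?c * (\<integral>\<^sup>+\<omega>. ?F \<omega> \<partial>M)" by (rule nn_integral_cmult) measurable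
  finally have 1: "emeasure M ?A \<le> ?c * (\<integral>\<^sup>+\<omega>. ?F \<omega> \<partial>M)" .
  have "(\<integral>\<^sup>+\<omega>. ?F \<omega> \<partial>M) = (\<integral>\<^sup>+t. (\<integral>\<^sup>+\<omega>. (\<Prod>j\<in>I. trunc_power d R (f \<omega> (?z t * u j))) * indicator {0..1} t \<partial>M) \<partial>lborel)"
    by (rule P.Fubini'[symmetric]) measurable
  also have "\<dots> = (\<integral>\<^sup>+t. (\<integral>\<^sup>+\<omega>. (\<Prod>j\<in>I. trunc_power d R (f \<omega> (?z t * u j))) \<partial>M) * indicator {0..1} t \<partial>lborel)"
    by (intro nn_integral_cong nn_integral_multc) measurable
  also have "\<dots> \<le> (\<integral>\<^sup>+t. ?K * indicator {0..1::real} t \<partial>lborel)"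
  proof (rule nn_integral_mono)
    fix t :: real
    have "(\<integral>\<^sup>+\<omega>. (\<Prod>j\<in>I. trunc_power d R (f \<omega> (?z t * u j))) \<partial>M) \<le>
      ennreal (\<Prod>k\<in>I. inverse ((a k * cmod (?z t) ^ k)\<^sup>2)) * (ennreal (1 / pi) * (\<integral>\<^sup>+z. trunc_power d R z \<partial>lborel)) ^ card I"
      using \<rho> by (intro nn_integral_prod_le[OF I contr _ radial_trunc_power _ pos]) auto
    also have "\<dots> \<le> ennreal (\<Prod>k\<in>I. inverse ((a k * cmod (?z t) ^ k)\<^sup>2)) * (ennreal (1 / pi) * ennreal (12 * pi * R powr d / d)) ^ card I"
      by (intro mult_left_mono power_mono nn_integral_trunc_power_le d R) auto
    also have "ennreal (1 / pi) * ennreal (12 * pi * R powr d / d) = ennreal (12 * R powr d / d)"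
      using d by (subst ennreal_mult[symmetric]) auto
    also have "ennreal (\<Prod>k\<in>I. inverse ((a k * cmod (?z t) ^ k)\<^sup>2)) * ennreal (12 * R powr d / d) ^ card I = ?K"
      using \<rho> d by (simp add: norm_mult ennreal_power ennreal_mult prod_nonneg mult.commute)
    finally have "(\<integral>\<^sup>+\<omega>. (\<Prod>j\<in>I. trunc_power d R (f \<omega> (?z t * u j))) \<partial>M) \<le> ?K" .
    then show "(\<integral>\<^sup>+\<omega>. (\<Prod>j\<in>I. trunc_power d R (f \<omega> (?z t * u j))) \<partial>M) * indicator {0..1} t \<le> ?K * indicator {0..1} t"
      by (rule mult_right_mono) simp
  qed
  also have "\<dots> = ?K" by (simp add: nn_integral_cmult_indicator)
  finally have "(\<integral>\<^sup>+\<omega>. ?F \<omega> \<partial>M) \<le> ?K" .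
  from order_trans[OF 1 mult_left_mono[OF this]] have "emeasure M ?A \<le> ?c * ?K" by simp
  also have "?c * ?K = ennreal ((B powr (2 - d) * (12 * R powr d / d)) ^ card I * (\<Prod>k\<in>I. inverse ((a k * \<rho> ^ k)\<^sup>2)))"
    unfolding power_mult_distrib[of "B powr (2 - d)" "12 * R powr d / d"] using d
    by (subst ennreal_power, simp, subst ennreal_mult[symmetric]) (auto simp: prod_nonneg mult.assoc)
  finally show ?thesis
    using d by (simp add: emeasure_eq_measure prod_nonneg)
qed

text \<open>
  The events \<open>\<bar>f 0\<bar> > B\<close> and \<open>majorant r > R\<close> are removed by the Gaussian tail and by Markov's inequality.
  The bound for the rest holds with every \<open>\<rho> < r\<close>, and \<open>\<rho>\<close> tends to \<open>r\<close> while the index set \<open>active r\<close> is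
  kept.
\<close>

lemma hole_probability_le:
  assumes r: "r > 0" and d: "0 < d" "d \<le> 1" and R: "R > 0" and B: "B > 0"
  shows "prob (hole_event M a \<xi> r) \<le>
     2 * exp (- (B / a 0)\<^sup>2 / 2) + 2 * (\<Sum>n. a n * r ^ n) / R +
     (B powr (2 - d) * (12 * R powr d / d)) ^ card (active r) * exp (- S a r)"
proof -
  let ?H = "hole_event M a \<xi> r"
  let ?A = "{\<omega>\<in>?H. cmod (f \<omega> 0) \<le> B \<and> majorant r \<omega> \<le> ennreal R}"
  let ?B1 = "{\<omega>\<in>space M. cmod (\<xi> 0 \<omega>) > B / a 0}"
  let ?B2 = "{\<omega>\<in>space M. 1 \<le> ennreal (1 / R) * majorant r \<omega>}"
  have [measurable]: "?A \<in> sets M"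
  proof -
    have "?A = {\<omega>\<in>space M. \<omega> \<in> ?H \<and> cmod (f \<omega> 0) \<le> B \<and> majorant r \<omega> \<le> ennreal R}"
      by (auto simp: hole_event_def)
    also have "\<dots> \<in> sets M" by measurable
    finally show ?thesis .
  qed
  have "?H \<subseteq> ?B1 \<union> ?B2 \<union> ?A"
  proof
    fix \<omega> assume \<omega>: "\<omega> \<in> ?H"
    then have sp: "\<omega> \<in> space M" by (simp add: hole_event_def)
    have "\<omega> \<in> ?B1" if "cmod (f \<omega> 0) > B"
      using that a0 sp by (simp add: f_0 norm_mult field_simps)
    moreover have "\<omega> \<in> ?B2" if "majorant r \<omega> > ennreal R"
    proof -
      have "1 = ennreal (1 / R) * ennreal R" using R by (subst ennreal_mult[symmetric]) auto
      also have "\<dots> \<le> ennreal (1 / R) * majorant r \<omega>" using that by (intro mult_left_mono) auto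
      finally show ?thesis using sp by simp
    qed
    ultimately show "\<omega> \<in> ?B1 \<union> ?B2 \<union> ?A" using \<omega> by fastforce
  qed
  then have "prob ?H \<le> prob (?B1 \<union> ?B2 \<union> ?A)" by (intro finite_measure_mono) auto
  also have "\<dots> \<le> prob ?B1 + prob ?B2 + prob ?A"
    by (intro order_trans[OF measure_Un_le] add_mono) auto
  also have "prob ?B1 \<le> 2 * exp (- (B / a 0)\<^sup>2 / 2)"
    using a0 B by (intro tail) auto
  also have "prob ?B2 \<le> 2 * (\<Sum>n. a n * r ^ n) / R"
  proof -
    have sum_nn: "(\<Sum>n. a n * r ^ n) \<ge> 0" using r nonneg summable_coeffs[of r] by (intro suminf_nonneg) auto
    have "emeasure M ?B2 \<le> ennreal (1 / R) * (\<integral>\<^sup>+\<omega>. majorant r \<omega> * indicator (space M) \<omega> \<partial>M)"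
      by (rule nn_integral_Markov_inequality) measurable
    also have "(\<integral>\<^sup>+\<omega>. majorant r \<omega> * indicator (space M) \<omega> \<partial>M) = (\<integral>\<^sup>+\<omega>. majorant r \<omega> \<partial>M)"
      by (intro nn_integral_cong) simp
    also have "ennreal (1 / R) * \<dots> \<le> ennreal (1 / R) * ennreal (2 * (\<Sum>n. a n * r ^ n))"
      using r by (intro mult_left_mono nn_integral_majorant_le) auto
    also have "\<dots> = ennreal (2 * (\<Sum>n. a n * r ^ n) / R)"
      using R sum_nn by (subst ennreal_mult[symmetric]) auto
    finally show ?thesis using R sum_nn by (simp add: emeasure_eq_measure)
  qed
  also have "prob ?A \<le> (B powr (2 - d) * (12 * R powr d / d)) ^ card (active r) * exp (- S a r)"
  proof -
    let ?C = "(B powr (2 - d) * (12 * R powr d / d)) ^ card (active r)"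
    let ?g = "\<lambda>\<rho>. ?C * (\<Prod>k\<in>active r. inverse ((a k * \<rho> ^ k)\<^sup>2))"
    have "a k * r ^ k > 1" if "k \<in> active r" for k using that by (simp add: active_def)
    then have "(a k * r ^ k)\<^sup>2 \<noteq> 0" if "k \<in> active r" for k using that by (metis not_one_less_zero zero_eq_power2)
    then have "isCont ?g r" by (intro continuous_intros)
    then have "(?g \<longlongrightarrow> ?g r) (at_left r)"
      by (simp add: isCont_def filterlim_at_split)
    moreover have "\<forall>\<^sub>F \<rho> in at_left r. prob ?A \<le> ?g \<rho>"
      using eventually_at_left_real[OF r]
    proof eventually_elim
      case (elim \<rho>)
      then show ?case by (intro truncated_hole_le d R B finite_active r active_pos) auto
    qed
    ultimately have "prob ?A \<le> ?g r"
      by (intro tendsto_lowerbound) auto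
    then show ?thesis using exp_minus_S[OF r] by simp
  qed
  finally show ?thesis by simp
qed

end

section \<open>Lower bound for the hole probability\<close>

lemma two_exp_minus_le: "2 * exp (- y\<^sup>2 / 2) \<le> 4 / y\<^sup>2" if "y > 0" for y :: real
proof -
  have "y\<^sup>2 / 2 \<le> exp (y\<^sup>2 / 2)" using exp_ge_add_one_self[of "y\<^sup>2 / 2"] by linarith
  then show ?thesis using that by (simp add: exp_minus field_simps)
qed

context gaussian_entire
begin

text \<open>
  The conditions are independent. Those outside \<open>J\<close> fail with probabilities of sum at most \<open>1 / 2\<close>, so by
  the Weierstrass product inequality they cost at most the factor \<open>1 / 2\<close>.
\<close>

lemma prob_controlled_coeffs_ge:
  assumes J: "finite J" and K: "K \<ge> 0" and x: "\<And>k. k \<in> J \<Longrightarrow> 0 \<le> x k \<and> x k \<le> 1"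
    and g: "0 < g"
  shows "prob {\<omega>\<in>space M. K \<le> cmod (\<xi> 0 \<omega>) \<and> (\<forall>k\<in>J - {0}. cmod (\<xi> k \<omega>) \<le> x k) \<and>
           (\<forall>k. k \<notin> J \<longrightarrow> k \<noteq> 0 \<longrightarrow> cmod (\<xi> k \<omega>) \<le> sqrt (8 / g) * exp (g * real k / 2))}
      \<ge> exp (- (K + 2)\<^sup>2) * (\<Prod>k\<in>J - {0}. exp (- 1) * (x k)\<^sup>2) / 2"
proof -
  \<comment> \<open>\<open>sqrt (8 / g)\<close> makes the sum of the failure probabilities \<open>4 / (y k)\<^sup>2\<close> at most \<open>1 / 2\<close>\<close>
  define y where "y k = (if k \<in> J then x k else sqrt (8 / g) * exp (g * real k / 2))" for k
  define A where "A k = (if k = 0 then {z. K \<le> cmod z} else {z. cmod z \<le> y k})" for k :: nat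
  define E where "E m = (\<Inter>k\<in>{..m}. \<xi> k -` A k \<inter> space M)" for m
  let ?p = "\<lambda>k. prob (\<xi> k -` A k \<inter> space M)"
  let ?b = "exp (- (K + 2)\<^sup>2) * (\<Prod>k\<in>J - {0}. exp (- 1) * (x k)\<^sup>2) / 2"
  have Aset[measurable]: "A k \<in> sets borel" for k unfolding A_def by (cases "k = 0") auto
  have p0: "?p 0 \<ge> exp (- (K + 2)\<^sup>2)"
    using prob_large[OF K, of 0] by (simp add: A_def vimage_def Int_def conj_commute)
  have pJ: "?p k \<ge> exp (- 1) * (x k)\<^sup>2" if "k \<in> J - {0}" for k
    using prob_small[of "x k" k] x[of k] that by (simp add: A_def y_def vimage_def Int_def conj_commute)
  have pt: "?p k \<ge> 1 - g / 2 * exp (- g) ^ k" if "k \<notin> J" "k \<noteq> 0" for k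
  proof -
    have yk: "y k > 0" using that g by (simp add: y_def)
    have "prob {\<omega>\<in>space M. cmod (\<xi> k \<omega>) > y k} \<le> 2 * exp (- (y k)\<^sup>2 / 2)"
      using yk by (intro tail) simp
    also have "\<dots> \<le> 4 / (y k)\<^sup>2" by (rule two_exp_minus_le[OF yk])
    also have "(y k)\<^sup>2 = 8 / g * exp (g * real k)"
      using that g by (simp add: y_def power_mult_distrib exp_double[symmetric])
    also have "4 / (8 / g * exp (g * real k)) = g / 2 * exp (- g) ^ k"
      by (simp add: exp_minus field_simps exp_of_nat_mult[symmetric] power_inverse[symmetric])
    finally have "prob {\<omega>\<in>space M. cmod (\<xi> k \<omega>) > y k} \<le> g / 2 * exp (- g) ^ k" .
    moreover have "?p k = 1 - prob {\<omega>\<in>space M. cmod (\<xi> k \<omega>) > y k}"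
    proof -
      have "\<xi> k -` A k \<inter> space M = space M - {\<omega>\<in>space M. cmod (\<xi> k \<omega>) > y k}"
        using that by (auto simp: A_def)
      then show ?thesis by (simp add: prob_compl)
    qed
    ultimately show ?thesis by simp
  qed
  have Em: "prob (E m) \<ge> ?b" if m: "\<And>k. k \<in> J \<Longrightarrow> k \<le> m" for m
  proof -
    let ?T = "{1..m} - J"
    have "prob (E m) = (\<Prod>k\<in>{..m}. ?p k)"
      unfolding E_def by (rule indep_varsD[OF indep]) auto
    also have "{..m} = insert 0 ((J - {0}) \<union> ?T)" using m by auto
    also have "(\<Prod>k\<in>\<dots>. ?p k) = ?p 0 * ((\<Prod>k\<in>J - {0}. ?p k) * (\<Prod>k\<in>?T. ?p k))"
    proof -
      have "(\<Prod>k\<in>(J - {0}) \<union> ?T. ?p k) = (\<Prod>k\<in>J - {0}. ?p k) * (\<Prod>k\<in>?T. ?p k)"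
        using J by (intro prod.union_disjoint) auto
      then show ?thesis using J by (subst prod.insert) auto
    qed
    finally have eq: "prob (E m) = ?p 0 * ((\<Prod>k\<in>J - {0}. ?p k) * (\<Prod>k\<in>?T. ?p k))" .
    have "1 / 2 \<le> (\<Prod>k\<in>?T. ?p k)"
    proof -
      have q: "0 \<le> exp (- g)" "exp (- g) < 1" using g by auto
      have "(\<Sum>k\<in>?T. 1 - ?p k) \<le> (\<Sum>k\<in>?T. g / 2 * exp (- g) ^ k)"
      proof (rule sum_mono)
        fix k assume "k \<in> ?T"
        then have "?p k \<ge> 1 - g / 2 * exp (- g) ^ k" by (intro pt) auto
        then show "1 - ?p k \<le> g / 2 * exp (- g) ^ k" by linarith
      qed
      also have "\<dots> \<le> (\<Sum>k\<in>{1..m}. g / 2 * exp (- g) ^ k)"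
        using g by (intro sum_mono2) auto
      also have "\<dots> = g / 2 * (\<Sum>k<m. exp (- g) ^ Suc k)"
        by (simp add: sum.atLeast1_atMost_eq sum_distrib_left del: power_Suc)
      also have "\<dots> \<le> g / 2 * (1 / g)"
      proof (intro mult_left_mono)
        have "(\<Sum>k<m. exp (- g) ^ Suc k) = exp (- g) * (\<Sum>k<m. exp (- g) ^ k)" by (simp add: sum_distrib_left)
        also have "\<dots> \<le> exp (- g) * (\<Sum>k. exp (- g) ^ k)"
          using q by (intro mult_left_mono sum_le_suminf summable_geometric) auto
        also have "\<dots> = exp (- g) / (1 - exp (- g))" using q by (simp add: suminf_geometric)
        also have "\<dots> = 1 / (exp g - 1)" using g by (simp add: exp_minus field_simps)
        also have "\<dots> \<le> 1 / g" using exp_ge_add_one_self[of g] g by (intro divide_left_mono mult_pos_pos) linarith+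
        finally show "(\<Sum>k<m. exp (- g) ^ Suc k) \<le> 1 / g" .
      qed (use g in auto)
      also have "\<dots> = 1 / 2" using g by simp
      finally have "1 / 2 \<le> 1 - (\<Sum>k\<in>?T. 1 - ?p k)" by simp
      also have "\<dots> \<le> (\<Prod>k\<in>?T. 1 - (1 - ?p k))"
        by (rule Weierstrass_prod_ineq) auto
      finally show ?thesis by simp
    qed
    moreover have "(\<Prod>k\<in>J - {0}. exp (- 1) * (x k)\<^sup>2) \<le> (\<Prod>k\<in>J - {0}. ?p k)"
      using pJ by (intro prod_mono) auto
    ultimately have "exp (- (K + 2)\<^sup>2) * ((\<Prod>k\<in>J - {0}. exp (- 1) * (x k)\<^sup>2) * (1 / 2)) \<le> prob (E m)"
      unfolding eq using p0 by (intro mult_mono) (auto intro!: prod_nonneg mult_nonneg_nonneg)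
    then show ?thesis by simp
  qed
  have "(\<lambda>m. prob (E m)) \<longlonglongrightarrow> prob (\<Inter>m. E m)"
    by (intro finite_Lim_measure_decseq) (auto simp: E_def decseq_def)
  moreover have "\<forall>\<^sub>F m in sequentially. prob (E m) \<ge> ?b"
    using J by (intro eventually_sequentiallyI[of "Max (insert 0 J)"] Em) (meson Max.coboundedI finite_insert insertI2 le_trans)
  ultimately have "prob (\<Inter>m. E m) \<ge> ?b"
    by (intro tendsto_lowerbound) auto
  also have "(\<Inter>m. E m) = {\<omega>\<in>space M. K \<le> cmod (\<xi> 0 \<omega>) \<and> (\<forall>k\<in>J - {0}. cmod (\<xi> k \<omega>) \<le> x k) \<and>
           (\<forall>k. k \<notin> J \<longrightarrow> k \<noteq> 0 \<longrightarrow> cmod (\<xi> k \<omega>) \<le> sqrt (8 / g) * exp (g * real k / 2))}"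
    (is "_ = ?R")
  proof -
    have "(\<Inter>m. E m) = {\<omega>\<in>space M. \<forall>k. \<xi> k \<omega> \<in> A k}" unfolding E_def by auto
    also have "\<dots> = ?R"
    proof -
      have "(\<forall>k. \<xi> k \<omega> \<in> A k) \<longleftrightarrow> K \<le> cmod (\<xi> 0 \<omega>) \<and> (\<forall>k. k \<noteq> 0 \<longrightarrow> cmod (\<xi> k \<omega>) \<le> y k)" for \<omega>
        unfolding A_def by auto
      then show ?thesis by (auto simp: y_def split: if_splits)
    qed
    finally show ?thesis .
  qed
  finally show ?thesis .
qed

text \<open>
  With \<open>J = active (r * exp g)\<close>, the terms with index in \<open>J - {0}\<close> add up to less than \<open>1\<close>. Outside \<open>J\<close> one has
  \<open>a k * r ^ k \<le> exp (- g * k)\<close>, and the coefficients may grow like \<open>exp (g * k / 2)\<close>, so these terms add up to at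
  most \<open>sqrt (8 / g) * (4 / g)\<close>. The number \<open>K\<close> is chosen so that the constant term exceeds the total.
\<close>

lemma hole_probability_ge:
  fixes r g :: real
  assumes r: "r > 0" and g: "0 < g" "g \<le> 1"
  defines "n \<equiv> real (card (active (r * exp g)))" and "K \<equiv> (1 + sqrt (8 / g) * (4 / g)) / a 0"
  shows "prob (hole_event M a \<xi> r) \<ge>
     exp (- (K + 2)\<^sup>2) * (exp (- 1) / (n + 1)\<^sup>2) ^ card (active (r * exp g)) * exp (- S a r) / 2"
proof -
  let ?J = "active (r * exp g)"
  define x where "x k = 1 / ((n + 1) * max (a k * r ^ k) 1)" for k
  define L where "L = sqrt (8 / g)"
  let ?E = "{\<omega>\<in>space M. K \<le> cmod (\<xi> 0 \<omega>) \<and> (\<forall>k\<in>?J - {0}. cmod (\<xi> k \<omega>) \<le> x k) \<and>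
           (\<forall>k. k \<notin> ?J \<longrightarrow> k \<noteq> 0 \<longrightarrow> cmod (\<xi> k \<omega>) \<le> sqrt (8 / g) * exp (g * real k / 2))}"
  have J: "finite ?J" using r by (intro finite_active) auto
  have n: "n \<ge> 0" by (simp add: n_def)
  have K: "K \<ge> 0" using a0 g by (simp add: K_def)
  have L: "L \<ge> 0" using g by (simp add: L_def)
  have m1: "max (a k * r ^ k) 1 \<ge> 1" for k by simp
  have x01: "0 \<le> x k \<and> x k \<le> 1" for k
    using n mult_mono[of 1 "n + 1" 1 "max (a k * r ^ k) 1"] by (auto simp: x_def)
  have off: "a k * r ^ k \<le> exp (- g * real k)" if "k \<notin> ?J" for k
  proof -
    have "a k * r ^ k = a k * (r * exp g) ^ k * exp (- g * real k)"
      by (simp add: power_mult_distrib exp_of_nat2_mult exp_minus)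
    also have "\<dots> \<le> 1 * exp (- g * real k)" using that by (intro mult_right_mono) (auto simp: active_def)
    finally show ?thesis by simp
  qed
  have sub: "?E \<inter> entire_outcomes \<subseteq> hole_event M a \<xi> r"
  proof
    fix \<omega> assume \<omega>: "\<omega> \<in> ?E \<inter> entire_outcomes"
    have "f \<omega> z \<noteq> 0" if z: "cmod z < r" for z
    proof -
      let ?t = "\<lambda>k. \<xi> k \<omega> * of_real (a k) * z ^ k"
      define v where "v = exp (- g / 2)"
      define c where "c k = (if k \<in> ?J then 1 / (n + 1) else 0) + L * v ^ k" for k
      have v: "0 \<le> v" "v < 1" using g by (auto simp: v_def)
      have bound: "cmod (?t k) \<le> c k" if "k \<noteq> 0" for k
      proof -
        have "cmod (?t k) = cmod (\<xi> k \<omega>) * (a k * cmod z ^ k)" using nonneg by (simp add: norm_mult norm_power)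
        also have "\<dots> \<le> cmod (\<xi> k \<omega>) * (a k * r ^ k)" using z nonneg by (intro mult_left_mono power_mono) auto
        also have "\<dots> \<le> c k"
        proof (cases "k \<in> ?J")
          case True
          then have "cmod (\<xi> k \<omega>) * (a k * r ^ k) \<le> x k * max (a k * r ^ k) 1"
            using \<omega> that x01 nonneg r by (intro mult_mono) auto
          also have "\<dots> = 1 / (n + 1)" using m1[of k] by (simp add: x_def)
          also have "\<dots> \<le> c k" using True L v by (simp add: c_def)
          finally show ?thesis .
        next
          case False
          then have "cmod (\<xi> k \<omega>) * (a k * r ^ k) \<le> (L * exp (g * real k / 2)) * exp (- g * real k)"
            using \<omega> that off[of k] L nonneg r by (intro mult_mono) (auto simp: L_def)
          also have "\<dots> = L * v ^ k" unfolding v_def exp_of_nat2_mult[symmetric]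
            by (simp add: exp_add[symmetric] field_simps)
          also have "\<dots> = c k" using False by (simp add: c_def)
          finally show ?thesis .
        qed
        finally show ?thesis .
      qed
      have csum: "c sums (n / (n + 1) + L * (1 / (1 - v)))"
      proof -
        have "(\<lambda>k. if k \<in> ?J then 1 / (n + 1) else 0) sums (\<Sum>k\<in>?J. 1 / (n + 1))"
          by (rule sums_If_finite_set[OF J])
        moreover have "(\<lambda>k. L * v ^ k) sums (L * (1 / (1 - v)))"
          using v by (intro sums_mult geometric_sums) auto
        ultimately have "(\<lambda>k. (if k \<in> ?J then 1 / (n + 1) else 0) + L * v ^ k) sums
            ((\<Sum>k\<in>?J. 1 / (n + 1)) + L * (1 / (1 - v)))" by (rule sums_add)
        then show ?thesis by (simp add: c_def[abs_def] n_def)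
      qed
      have "(\<lambda>k. if k \<in> {0} then 0 else ?t k) sums (f \<omega> z - \<xi> 0 \<omega> * of_real (a 0))"
      proof -
        have "\<omega> \<in> entire_outcomes" using \<omega> by blast
        from sums_diff[OF f_sums[OF this, of z] sums_If_finite_set[of "{0}" "?t"]]
        have "(\<lambda>k. ?t k - (if k \<in> {0} then ?t k else 0)) sums (f \<omega> z - \<xi> 0 \<omega> * of_real (a 0))" by simp
        moreover have "(\<lambda>k. ?t k - (if k \<in> {0} then ?t k else 0)) = (\<lambda>k. if k \<in> {0} then 0 else ?t k)"
          by auto
        ultimately show ?thesis by metis
      qed
      then have rest: "(\<lambda>k. if k = 0 then 0 else ?t k) sums (f \<omega> z - \<xi> 0 \<omega> * of_real (a 0))" by simp
      have "cmod (f \<omega> z - \<xi> 0 \<omega> * of_real (a 0)) \<le> n / (n + 1) + L * (1 / (1 - v))"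
      proof (rule norm_sums_le[OF rest csum])
        show "norm (if k = 0 then 0 else ?t k) \<le> c k" for k
          using bound[of k] n L v by (auto simp: c_def)
      qed
      also have "\<dots> < 1 + L * (4 / g)"
      proof -
        have "g / 4 \<le> 1 - v" using one_minus_exp_ge[of "g / 2"] g by (simp add: v_def)
        then have "1 / (1 - v) \<le> 4 / g" using g by (simp add: field_simps)
        then have "L * (1 / (1 - v)) \<le> L * (4 / g)" using L by (rule mult_left_mono)
        moreover have "n / (n + 1) < 1" using n by simp
        ultimately show ?thesis by linarith
      qed
      also have "\<dots> = K * a 0" using a0 by (simp add: K_def L_def)
      also have "\<dots> \<le> cmod (\<xi> 0 \<omega>) * a 0" using \<omega> a0 by (intro mult_right_mono) auto
      also have "\<dots> = cmod (\<xi> 0 \<omega> * of_real (a 0))" using a0 by (simp add: norm_mult)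
      finally show "f \<omega> z \<noteq> 0" by auto
    qed
    then show "\<omega> \<in> hole_event M a \<xi> r" using \<omega> by (auto simp: hole_event_eq)
  qed
  have Em[measurable]: "?E \<in> sets M" by measurable
  have "(\<Prod>k\<in>?J - {0}. exp (- 1) * (x k)\<^sup>2) \<ge> (exp (- 1) / (n + 1)\<^sup>2) ^ card ?J * exp (- S a r)"
  proof -
    have act: "active r \<subseteq> ?J"
      using r g nonneg by (auto simp: active_def elim!: less_le_trans intro!: mult_left_mono power_mono)
    have "exp (- S a r) = (\<Prod>k\<in>active r. inverse ((max (a k * r ^ k) 1)\<^sup>2))"
      unfolding exp_minus_S[OF r] by (intro prod.cong) (auto simp: active_def max_def)
    also have "\<dots> = (\<Prod>k\<in>?J. inverse ((max (a k * r ^ k) 1)\<^sup>2))"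
      using J act by (intro prod.mono_neutral_left) (auto simp: active_def max_def not_less)
    finally have "(exp (- 1) / (n + 1)\<^sup>2) ^ card ?J * exp (- S a r) =
       (\<Prod>k\<in>?J. exp (- 1) / (n + 1)\<^sup>2 * inverse ((max (a k * r ^ k) 1)\<^sup>2))"
      unfolding prod.distrib by simp
    also have "\<dots> = (\<Prod>k\<in>?J. exp (- 1) * (x k)\<^sup>2)"
      by (intro prod.cong) (auto simp: x_def power_mult_distrib divide_inverse power_inverse)
    also have "\<dots> \<le> (\<Prod>k\<in>?J - {0}. exp (- 1) * (x k)\<^sup>2)"
    proof (cases "0 \<in> ?J")
      case True
      have "exp (- 1) * (x 0)\<^sup>2 \<le> 1" using x01[of 0] by (intro mult_le_one power_le_one) auto
      then show ?thesis
        unfolding prod.remove[OF J True] by (intro mult_left_le_one_le prod_nonneg) auto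
    qed simp
    finally show ?thesis .
  qed
  then have "exp (- (K + 2)\<^sup>2) * ((exp (- 1) / (n + 1)\<^sup>2) ^ card ?J * exp (- S a r)) / 2
    \<le> exp (- (K + 2)\<^sup>2) * (\<Prod>k\<in>?J - {0}. exp (- 1) * (x k)\<^sup>2) / 2"
    by (intro divide_right_mono mult_left_mono) auto
  also have "\<dots> \<le> prob ?E"
    by (rule prob_controlled_coeffs_ge[OF J K x01 g(1)])
  also have "\<dots> = prob (?E \<inter> entire_outcomes)"
  proof (rule finite_measure_eq_AE)
    show "AE \<omega> in M. \<omega> \<in> ?E \<longleftrightarrow> \<omega> \<in> ?E \<inter> entire_outcomes"
      using AE_entire by eventually_elim blast
  qed (use Em entire_outcomes_sets in \<open>auto simp del: mem_Collect_eq\<close>)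
  also have "\<dots> \<le> prob (hole_event M a \<xi> r)" by (rule finite_measure_mono[OF sub hole_event_sets])
  finally show ?thesis by (simp add: mult.assoc)
qed

end

section \<open>Asymptotics\<close>

context rapid_coeffs
begin

text \<open>
  The following four functions express all errors through \<open>x = S a r\<close>. The first bounds \<open>1 / g\<close> and the second
  the number of active indices for the \<open>g\<close> of \<open>regular_radius\<close>.
\<close>

definition width_inverse :: "real \<Rightarrow> real" where
  "width_inverse x = 2 * (2 * ln x + 1)\<^sup>2"

definition count_bound :: "real \<Rightarrow> real" where
  "count_bound x = 1 + 2 * sqrt x * (2 * ln x + 1)"

definition upper_error :: "real \<Rightarrow> real" where
  "upper_error x = ln 2 + ((1 + sqrt (8 * width_inverse x) * (4 * width_inverse x)) / a 0 + 2)\<^sup>2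
     + count_bound x * (1 + 2 * ln (count_bound x + 1))"

definition lower_error :: "real \<Rightarrow> real" where
  "lower_error x = ln 4 + count_bound x * ln (36 * exp 1 * x * (1 + a 0 * sqrt (2 * x))\<^sup>2)"

lemma errors_negligible:
  "((\<lambda>x. upper_error x / x) \<longlongrightarrow> 0) at_top" "((\<lambda>x. lower_error x / x) \<longlongrightarrow> 0) at_top"
  "\<forall>\<^sub>F x in at_top. 2 * (count_bound x * exp x + 2 * width_inverse x) \<le> exp (2 * x)"
  using a0 unfolding upper_error_def lower_error_def count_bound_def width_inverse_def by real_asymp+

end

context gaussian_entire
begin

lemma p_H_le:
  assumes k: "k \<ge> 1" "a k > 0" and r: "r \<ge> 1" "r \<notin> exceptional" "S a r \<ge> 1"
  shows "measure M (hole_event M a \<xi> r) > 0" "p_H M a \<xi> r \<le> S a r + upper_error (S a r)"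
proof -
  define x where "x = S a r"
  obtain g where g: "0 < g" "g \<le> 1" "1 / g \<le> width_inverse x"
    and card: "real (card (active (r * exp g))) \<le> count_bound x"
    using regular_radius[OF k r] by (metis x_def width_inverse_def count_bound_def)
  define n where "n = card (active (r * exp g))"
  define K where "K = (1 + sqrt (8 / g) * (4 / g)) / a 0"
  define P where "P = exp (- (K + 2)\<^sup>2) * (exp (- 1) / (real n + 1)\<^sup>2) ^ n * exp (- x) / 2"
  have P: "P > 0" by (simp add: P_def)
  have le: "P \<le> prob (hole_event M a \<xi> r)"
    using hole_probability_ge[of r g] r g by (simp add: P_def K_def n_def x_def)
  show pos: "prob (hole_event M a \<xi> r) > 0" using P le by linarith
  have K: "0 \<le> K" "K \<le> (1 + sqrt (8 * width_inverse x) * (4 * width_inverse x)) / a 0"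
  proof -
    show "0 \<le> K" using g a0 by (simp add: K_def)
    have "sqrt (8 / g) * (4 / g) \<le> sqrt (8 * width_inverse x) * (4 * width_inverse x)"
      using g by (intro mult_mono) (auto simp: width_inverse_def)
    then show "K \<le> (1 + sqrt (8 * width_inverse x) * (4 * width_inverse x)) / a 0"
      unfolding K_def using a0 by (intro divide_right_mono) auto
  qed
  have "p_H M a \<xi> r \<le> - ln P"
    unfolding p_H_def using P le by simp
  also have "ln P = - (K + 2)\<^sup>2 + real n * (- 1 - 2 * ln (real n + 1)) - x - ln 2"
    by (simp add: P_def ln_mult ln_div ln_realpow)
  also have "- (- (K + 2)\<^sup>2 + real n * (- 1 - 2 * ln (real n + 1)) - x - ln 2)
      = x + (ln 2 + (K + 2)\<^sup>2 + real n * (1 + 2 * ln (real n + 1)))" by (simp add: algebra_simps)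
  also have "\<dots> \<le> x + upper_error x"
  proof -
    have "(K + 2)\<^sup>2 \<le> ((1 + sqrt (8 * width_inverse x) * (4 * width_inverse x)) / a 0 + 2)\<^sup>2"
      using K by (intro power_mono) auto
    moreover have "real n * (1 + 2 * ln (real n + 1)) \<le> count_bound x * (1 + 2 * ln (count_bound x + 1))"
      using card by (intro mult_mono) (auto simp: n_def)
    ultimately show ?thesis by (simp add: upper_error_def)
  qed
  finally show "p_H M a \<xi> r \<le> S a r + upper_error (S a r)" by (simp add: x_def)
qed

text \<open>
  The parameters make the two removed events of probability at most \<open>2 * exp (- x)\<close> and \<open>exp (- x)\<close>, and
  \<open>d = 1 / ln R\<close> makes \<open>R powr d\<close> constant.
\<close>

lemma p_H_ge:
  assumes k: "k \<ge> 1" "a k > 0" and r: "r \<ge> 1" "r \<notin> exceptional" "S a r \<ge> 1"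
    and large: "2 * (count_bound (S a r) * exp (S a r) + 2 * width_inverse (S a r)) \<le> exp (2 * S a r)"
  shows "p_H M a \<xi> r \<ge> S a r - lower_error (S a r)"
proof -
  define x where "x = S a r"
  have x: "x \<ge> 1" using r by (simp add: x_def)
  obtain g where g: "0 < g" "g \<le> 1" "1 / g \<le> width_inverse x"
    and card: "real (card (active (r * exp g))) \<le> count_bound x"
    using regular_radius[OF k r] by (metis x_def width_inverse_def count_bound_def)
  define m where "m = card (active r)"
  \<comment> \<open>chosen so that \<open>(B / a 0)\<^sup>2 / 2 = x\<close>\<close>
  define B where "B = a 0 * sqrt (2 * x)"
  define R where "R = exp (3 * x)"
  define d where "d = 1 / (3 * x)"
  define Q where "Q = 36 * exp 1 * x * (1 + B)\<^sup>2"
  have B: "B > 0" using a0 x by (simp add: B_def)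
  have d: "0 < d" "d \<le> 1" using x by (auto simp: d_def)
  have m: "real m \<le> count_bound x"
  proof -
    have "m \<le> card (active (r * exp g))" unfolding m_def using r g
      by (intro card_mono finite_active active_mono) auto
    then show ?thesis using card by linarith
  qed
  have Q: "Q \<ge> 1"
  proof -
    have "1 * 1 \<le> (36 * exp 1 * x) * (1 + B)\<^sup>2"
      using x B by (intro mult_mono one_le_power) (auto intro!: mult_ge1_I)
    then show ?thesis by (simp add: Q_def)
  qed
  have t1: "2 * exp (- (B / a 0)\<^sup>2 / 2) = 2 * exp (- x)"
    using a0 x by (simp add: B_def)
  have t2: "2 * (\<Sum>n. a n * r ^ n) / R \<le> exp (- x)"
  proof -
    have "(\<Sum>n. a n * r ^ n) \<le> real (card (active (r * exp g))) * exp x + 2 / g"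
      using suminf_coeffs_le[of r g] r g by (simp add: x_def)
    also have "\<dots> \<le> count_bound x * exp x + 2 * width_inverse x"
      using card g by (intro add_mono mult_right_mono) auto
    finally have "2 * (\<Sum>n. a n * r ^ n) \<le> exp (2 * x)" using large by (simp add: x_def)
    then have "2 * (\<Sum>n. a n * r ^ n) / R \<le> exp (2 * x) / R" by (intro divide_right_mono) (auto simp: R_def)
    also have "\<dots> = exp (- x)" by (simp add: R_def exp_diff[symmetric])
    finally show ?thesis .
  qed
  have t3: "(B powr (2 - d) * (12 * R powr d / d)) ^ m \<le> Q ^ m"
  proof (rule power_mono)
    have "B powr (2 - d) \<le> (1 + B) powr (2 - d)" using B d by (intro powr_mono2) auto
    also have "\<dots> \<le> (1 + B) powr 2" using B d by (intro powr_mono) auto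
    also have "\<dots> = (1 + B)\<^sup>2" using B by simp
    finally have "B powr (2 - d) \<le> (1 + B)\<^sup>2" .
    moreover have "R powr d = exp 1" using x by (simp add: R_def d_def powr_def)
    moreover have "12 * exp 1 / d = 36 * exp 1 * x" by (simp add: d_def)
    ultimately have "B powr (2 - d) * (12 * R powr d / d) \<le> (1 + B)\<^sup>2 * (36 * exp 1 * x)"
      using x by (simp only:) (intro mult_right_mono, auto)
    then show "B powr (2 - d) * (12 * R powr d / d) \<le> Q" by (simp add: Q_def mult_ac)
  qed (use d in auto)
  have "prob (hole_event M a \<xi> r) \<le> 2 * exp (- (B / a 0)\<^sup>2 / 2) + 2 * (\<Sum>n. a n * r ^ n) / R +
     (B powr (2 - d) * (12 * R powr d / d)) ^ m * exp (- x)"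
    using hole_probability_le[of r d R B] r d B by (simp add: R_def m_def x_def)
  also have "\<dots> \<le> 2 * exp (- x) + exp (- x) + Q ^ m * exp (- x)"
    unfolding t1 using t2 t3 by (intro add_mono mult_right_mono) auto
  also have "\<dots> = (3 + Q ^ m) * exp (- x)" by (simp add: algebra_simps)
  also have "\<dots> \<le> (4 * Q ^ m) * exp (- x)"
    using one_le_power[OF Q, of m] by (intro mult_right_mono) auto
  finally have le: "prob (hole_event M a \<xi> r) \<le> 4 * Q ^ m * exp (- x)" .
  have "ln (prob (hole_event M a \<xi> r)) \<le> ln (4 * Q ^ m * exp (- x))"
    using le p_H_le(1)[OF k r] by (intro ln_mono)
  also have "\<dots> = ln 4 + real m * ln Q - x"
    using Q by (simp add: ln_mult ln_realpow)
  also have "\<dots> \<le> ln 4 + count_bound x * ln Q - x"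
    using m Q by (intro diff_right_mono add_left_mono mult_right_mono) auto
  also have "\<dots> = lower_error x - x" by (simp add: lower_error_def Q_def B_def)
  finally show ?thesis by (simp add: p_H_def x_def)
qed

lemma p_H_asymptotics:
  assumes k: "k \<ge> 1" "a k > 0" and \<epsilon>: "\<epsilon> > 0"
  shows "\<exists>r0. \<forall>r\<ge>r0. r \<notin> exceptional \<longrightarrow> \<bar>p_H M a \<xi> r - S a r\<bar> \<le> \<epsilon> * S a r"
proof -
  have "\<forall>\<^sub>F x in at_top. x \<ge> 1 \<and> upper_error x \<le> \<epsilon> * x \<and> lower_error x \<le> \<epsilon> * x \<and>
     2 * (count_bound x * exp x + 2 * width_inverse x) \<le> exp (2 * x)"
    using eventually_ge_at_top[of 1] order_tendstoD(2)[OF errors_negligible(1) \<epsilon>]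
      order_tendstoD(2)[OF errors_negligible(2) \<epsilon>] errors_negligible(3)
  proof eventually_elim
    case (elim x)
    then show ?case by (auto simp: field_simps)
  qed
  from eventually_compose_filterlim[OF this S_at_top[OF k]] eventually_ge_at_top[of 1]
  have "\<forall>\<^sub>F r in at_top. r \<notin> exceptional \<longrightarrow> \<bar>p_H M a \<xi> r - S a r\<bar> \<le> \<epsilon> * S a r"
  proof eventually_elim
    case (elim r)
    then show ?case
      using p_H_le(2)[OF k, of r] p_H_ge[OF k, of r] by (auto simp: abs_le_iff)
  qed
  then show ?thesis by (simp add: eventually_at_top_linorder)
qed

text \<open>
  If all \<open>a n\<close> with \<open>n \<ge> 1\<close> vanish, \<open>S\<close> does not tend to infinity; but then \<open>f\<close> is a constant, almost surely not \<open>0\<close>, and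
  \<open>a 0 \<le> 1\<close> makes \<open>S\<close> vanish as well.
\<close>

lemma p_H_constant:
  assumes "\<And>n. n \<ge> 1 \<Longrightarrow> a n = 0" "a 0 \<le> 1"
  shows "S a r = 0" "p_H M a \<xi> r = 0"
proof -
  have "logp (a n * r ^ n) = 0" for n
    using assms a0 by (cases "n = 0") (auto simp: logp_def max_def)
  then show "S a r = 0" by (simp add: S_def)
  have const: "f \<omega> z = \<xi> 0 \<omega> * of_real (a 0)" for \<omega> z
    unfolding gef_def using assms(1) by (subst suminf_finite[of "{0}"]) auto
  have "AE \<omega> in M. \<omega> \<in> hole_event M a \<xi> r"
    using AE_entire AE_nonzero[of 0]
  proof eventually_elim
    case (elim \<omega>)
    then show ?case using a0 by (simp add: hole_event_eq const)
  qed
  then have "prob (hole_event M a \<xi> r) = 1" by (simp add: prob_eq_1)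
  then show "p_H M a \<xi> r = 0" by (simp add: p_H_def)
qed

end

theorem theorem1:
  fixes a :: "nat \<Rightarrow> real"
  assumes nonneg: "\<And>n. a n \<ge> 0"
    and a0: "a 0 > 0"
    and decay: "(\<lambda>n. elog (a n) / ereal (real n)) \<longlonglongrightarrow> -\<infinity>"
    and nondegenerate: "a 0 > 1 \<Longrightarrow> \<exists>n\<ge>1. a n > 0"
  shows "\<exists>E. E \<subseteq> {1..} \<and> E \<in> sets borel \<and>
             (\<integral>\<^sup>+t\<in>E. ennreal (1 / t) \<partial>lborel) < \<infinity> \<and>
             (\<forall>(M :: 'w measure) \<xi>. iid_std_complex_gaussian M \<xi> \<longrightarrow>
               (\<forall>\<epsilon>>0. \<exists>r0. \<forall>r\<ge>r0. r \<notin> E \<longrightarrow>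
                  \<bar>p_H M a \<xi> r - S a r\<bar> \<le> \<epsilon> * S a r))"
proof -
  interpret rapid_coeffs a by (rule rapid_coeffs_of_decay[OF nonneg a0 decay])
  have ge: "gaussian_entire M \<xi> a" if "iid_std_complex_gaussian M \<xi>" for M :: "'w measure" and \<xi>
    using that by (intro gaussian_entire.intro iid_gaussiansI rapid_coeffs_axioms)
  show ?thesis
  proof (cases "\<exists>k\<ge>1. a k > 0")
    case True
    then obtain k where k: "k \<ge> 1" "a k > 0" by blast
    show ?thesis
    proof (intro exI[of _ exceptional] conjI allI impI)
      show "exceptional \<subseteq> {1..}" by (auto simp: exceptional_def)
      show "\<exists>r0. \<forall>r\<ge>r0. r \<notin> exceptional \<longrightarrow> \<bar>p_H M a \<xi> r - S a r\<bar> \<le> \<epsilon> * S a r"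
        if "iid_std_complex_gaussian M \<xi>" "\<epsilon> > 0" for M :: "'w measure" and \<xi> \<epsilon>
        by (rule gaussian_entire.p_H_asymptotics[OF ge[OF that(1)] k that(2)])
    qed (rule exceptional_borel exceptional_measure)+
  next
    case False
    then have 0: "a n = 0" if "n \<ge> 1" for n using that nonneg[of n] by (metis order_le_less)
    have 1: "a 0 \<le> 1" using False nondegenerate by force
    show ?thesis
      by (intro exI[of _ "{}"]) (auto simp: gaussian_entire.p_H_constant[OF ge 0 1])
  qed
qed

end
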